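(* Let $d=1$, $M\ge1$, $a_1,\dots,a_M\in[0,1]$ with $\sum_i a_i=1$. Let $\sigma_1,\dots,\sigma_M>0$, confining potentials $V_i:\mathbb{R}\to\mathbb{R}$ and interaction potentials $F_{ij}(x)=\frac{\alpha_{ij}}2x^2$ with $\alpha_{ij}\ge0$, $\alpha_{ii}>0$, satisfy the structural condition $\frac{\alpha_{ij}}{\sigma_i^2}=\frac{\alpha_j}{\sigma^2}$, $\frac{V_i}{\sigma_i^2}=\frac{\overline V}{\sigma^2}$ for all $i,j$, with $\sigma>0$, coefficients $\alpha_j$, and the bistable potential $\overline V(x)=\frac{x^4}4-\frac{x^2}2$. Let $\overline\alpha_1=\sum_{\ell}a_\ell\alpha_\ell$, $\overline V^0(x)=\overline V(x)+\frac{\overline\alpha_1}{2}x^2$, and let $\sigma_c$ be the critical value, i.e. the unique positive solution of $$\frac{\int_{\mathbb{R}}x^2e^{-\frac{2}{\sigma_c^2}\overline V^0(x)}dx}{\int_{\mathbb{R}}e^{-\frac2{\sigma_c^2}\overline V^0(x)}dx}=\frac{\sigma_c^2}{2\overline\alpha_1}.$$ Consider the linearized system, for $i=1,\dots,M$, $$\partial_t\mu^{L,i}_t=\partial_x\Big[\Big(\overline V'+\sum_{j=1}^M a_j\alpha_j(x-m_j^\infty)\Big)\mu^{L,i}_t-\sum_{j=1}^M a_j\alpha_jm_j(t)\,\mu^i_\infty\Big]+\frac{\sigma^2}2\partial_x^2\mu_t^{L,i},$$ where $m_j(t)=\int y\,\mu_t^{L,j}(y)\,dy$, $m_j^\infty=\int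 x\,\mu_\infty^j(x)\,dx$, and $(\mu_\infty^1,\dots,\mu_\infty^M)=(\mu_\sigma,\dots,\mu_\sigma)$ is the symmetric stationary state $\mu_\sigma(x)=e^{-\frac2{\sigma^2}\overline V^0(x)}/\int e^{-\frac2{\sigma^2}\overline V^0}$ (which is the unique stationary state for $\sigma\ge\sigma_c$). Then: (a) For $\sigma>\sigma_c$, the linearized system is stable, that is, perturbations from the unique stationary distribution decay to zero exponentially fast in $L^2(\mathbb{R},\rho_\infty)$, where $\rho_\infty=\mu_\sigma$. (b) At $\sigma=\sigma_c$, the null space of the linearized McKean-Vlasov operator (the right-hand side of the linearized system) is two-dimensional and consists of (is spanned by) $(\mu_\sigma,\dots,\mu_\sigma)$ and $(x\mu_\sigma,\dots,x\mu_\sigma)$.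
   Context: The linearized system arises by writing $\mu_t^i=\mu_\infty^i+\epsilon\mu_t^{L,i}$ in the coupled McKean-Vlasov equations $\partial_t\mu^i_t=\partial_x[(V_i'+\sum_ja_jF_{ij}'*\mu^j_t)\mu^i_t]+\frac{\sigma_i^2}2\partial_x^2\mu^i_t$ (up to a species-dependent time rescaling) and keeping terms of order $\epsilon$; since the $\mu^i_t$ are probability densities, perturbations $\mu^{L,i}_t$ have zero total mass. Perturbations are written as $\mu^{L,i}_t=h^i_t\rho_\infty$ and measured through the norm of $h^i_t$ in $L^2(\mathbb{R},\rho_\infty)$.
   Formalization: In (b) the null space is taken among tuples whose components all have the same total mass; without this, for M ≥ 2, (μ_σ,0,…,0) is also annihilated and the null space has dimension M+1, so the claim fails. For M = 1 the restriction is void. *)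

theory Defs
  imports "HOL-Analysis.Analysis" "HOL-Library.Function_Algebras"
begin

text \<open>
  The \<open>M\<close> species are indexed by a finite type \<open>'m\<close>, so \<open>M = CARD('m) \<ge> 1\<close>.
  A tuple of functions on the line is a function \<open>'m \<Rightarrow> real \<Rightarrow> real\<close>.
  Throughout, \<open>a\<close> are the species weights, \<open>al\<close> the coefficients \<open>\<alpha>\<^sub>j\<close>,
  \<open>A\<close> stands for \<open>\<Sum>\<^sub>l a\<^sub>l \<alpha>\<^sub>l\<close> and \<open>s\<close> for \<open>\<sigma>\<close>.
\<close>

definition Vbar :: "real \<Rightarrow> real" where
  "Vbar x = x ^ 4 / 4 - x ^ 2 / 2"

definition abar :: "('m::finite \<Rightarrow> real) \<Rightarrow> ('m \<Rightarrow> real) \<Rightarrow> real" where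
  "abar a al = (\<Sum>l\<in>UNIV. a l * al l)"

definition Vbar0 :: "real \<Rightarrow> real \<Rightarrow> real" where
  "Vbar0 A x = Vbar x + A / 2 * x ^ 2"

definition gibbs_weight :: "real \<Rightarrow> real \<Rightarrow> real \<Rightarrow> real" where
  "gibbs_weight A s x = exp (- (2 / s ^ 2) * Vbar0 A x)"

definition gibbs :: "real \<Rightarrow> real \<Rightarrow> real \<Rightarrow> real" where
  "gibbs A s x = gibbs_weight A s x / (\<integral>y. gibbs_weight A s y \<partial>lborel)"

definition critical_equation :: "real \<Rightarrow> real \<Rightarrow> bool" where
  "critical_equation A s \<longleftrightarrow>
     (\<integral>x. x ^ 2 * gibbs_weight A s x \<partial>lborel) / (\<integral>x. gibbs_weight A s x \<partial>lborel)
       = s ^ 2 / (2 * A)"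

definition mass :: "(real \<Rightarrow> real) \<Rightarrow> real" where
  "mass f = (\<integral>x. f x \<partial>lborel)"

definition first_moment :: "(real \<Rightarrow> real) \<Rightarrow> real" where
  "first_moment f = (\<integral>x. x * f x \<partial>lborel)"

definition in_L2 :: "(real \<Rightarrow> real) \<Rightarrow> (real \<Rightarrow> real) \<Rightarrow> bool" where
  "in_L2 \<rho> h \<longleftrightarrow> h \<in> borel_measurable borel \<and>
     integrable (density lborel (\<lambda>x. ennreal (\<rho> x))) (\<lambda>x. (h x) ^ 2)"

definition L2_norm :: "(real \<Rightarrow> real) \<Rightarrow> (real \<Rightarrow> real) \<Rightarrow> real" where
  "L2_norm \<rho> h = sqrt (\<integral>x. (h x) ^ 2 \<partial>density lborel (\<lambda>x. ennreal (\<rho> x)))"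

text \<open>Perturbations are written \<open>\<mu>\<^sup>i = h\<^sup>i \<rho>\<close> with \<open>\<rho> > 0\<close> and measured through \<open>h\<^sup>i\<close>.\<close>

definition perturbation_norm ::
  "(real \<Rightarrow> real) \<Rightarrow> ('m::finite \<Rightarrow> real \<Rightarrow> real) \<Rightarrow> real" where
  "perturbation_norm \<rho> \<mu> = sqrt (\<Sum>i\<in>UNIV. (L2_norm \<rho> (\<lambda>x. \<mu> i x / \<rho> x)) ^ 2)"

text \<open>
  The linearization at \<open>(\<mu>\<^sub>\<sigma>, \<dots>, \<mu>\<^sub>\<sigma>)\<close>, acting on densities (not on the \<open>h\<^sup>i\<close>).
\<close>

definition lin_op ::
  "('m::finite \<Rightarrow> real) \<Rightarrow> ('m \<Rightarrow> real) \<Rightarrow> real \<Rightarrow> ('m \<Rightarrow> real \<Rightarrow> real) \<Rightarrow> 'm \<Rightarrow> real \<Rightarrow> real" where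
  "lin_op a al s \<mu> i x =
     (let \<mu>inf = (\<lambda>j::'m. gibbs (abar a al) s) in
      deriv (\<lambda>y. (deriv Vbar y + (\<Sum>j\<in>UNIV. a j * al j * (y - first_moment (\<mu>inf j)))) * \<mu> i y
                  - (\<Sum>j\<in>UNIV. a j * al j * first_moment (\<mu> j)) * \<mu>inf i y) x
      + s ^ 2 / 2 * deriv (deriv (\<mu> i)) x)"

text \<open>
  The maximal domain in \<open>L\<^sup>2(\<rho>)\<close>; differentiability makes the total operator \<open>deriv\<close> meaningful.
\<close>

definition lin_dom ::
  "('m::finite \<Rightarrow> real) \<Rightarrow> ('m \<Rightarrow> real) \<Rightarrow> real \<Rightarrow> ('m \<Rightarrow> real \<Rightarrow> real) set" where
  "lin_dom a al s =
     (let \<rho> = gibbs (abar a al) s in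
      {\<mu>. \<forall>i. (\<forall>x. \<mu> i field_differentiable at x) \<and>
               (\<forall>x. deriv (\<mu> i) field_differentiable at x) \<and>
               in_L2 \<rho> (\<lambda>x. \<mu> i x / \<rho> x) \<and>
               in_L2 \<rho> (\<lambda>x. lin_op a al s \<mu> i x / \<rho> x)})"

text \<open>
  Solutions of \<open>\<partial>\<^sub>t \<mu> = lin_op \<mu>\<close> are classical solutions of the abstract Cauchy problem in
  \<open>L\<^sup>2(\<rho>)\<close>: the curve \<open>t \<mapsto> h\<^sub>t\<close> is continuous at \<open>t = 0\<close>, and for \<open>t > 0\<close> it lies in the
  domain and is norm differentiable with the right-hand side as derivative.  The initial value is
  an arbitrary element of \<open>L\<^sup>2(\<rho>)\<close>, not necessarily in the domain.
\<close>

definition lin_solution ::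
  "('m::finite \<Rightarrow> real) \<Rightarrow> ('m \<Rightarrow> real) \<Rightarrow> real \<Rightarrow> (real \<Rightarrow> 'm \<Rightarrow> real \<Rightarrow> real) \<Rightarrow> bool" where
  "lin_solution a al s \<mu> \<longleftrightarrow>
     (let \<rho> = gibbs (abar a al) s in
      (\<forall>t\<ge>0. \<forall>i. in_L2 \<rho> (\<lambda>x. \<mu> t i x / \<rho> x)) \<and>
      ((\<lambda>t. perturbation_norm \<rho> (\<lambda>i x. \<mu> t i x - \<mu> 0 i x)) \<longlongrightarrow> 0) (at_right 0) \<and>
      (\<forall>t>0. \<mu> t \<in> lin_dom a al s \<and>
         ((\<lambda>r. perturbation_norm \<rho>
                 (\<lambda>i x. (\<mu> r i x - \<mu> t i x) / (r - t) - lin_op a al s (\<mu> t) i x)) \<longlongrightarrow> 0) (at t)))"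

definition lin_null_space ::
  "('m::finite \<Rightarrow> real) \<Rightarrow> ('m \<Rightarrow> real) \<Rightarrow> real \<Rightarrow> ('m \<Rightarrow> real \<Rightarrow> real) set" where
  "lin_null_space a al s = {\<mu> \<in> lin_dom a al s. \<forall>i x. lin_op a al s \<mu> i x = 0}"

text \<open>
  The linear span of the admissible states: these are \<open>M\<close>-tuples of probability densities, so
  they span the tuples of integrable functions whose components have a common total mass.  The
  null space is taken there.  Among tuples with independent masses, \<open>(\<mu>\<^sub>\<sigma>, 0, \<dots>, 0)\<close> is
  annihilated as well, and the kernel at \<open>\<sigma> = \<sigma>\<^sub>c\<close> has dimension \<open>M + 1\<close>.
\<close>

definition common_mass :: "('m::finite \<Rightarrow> real \<Rightarrow> real) set" where
  "common_mass = {\<mu>. (\<forall>i. integrable lborel (\<mu> i)) \<and> (\<forall>i j. mass (\<mu> i) = mass (\<mu> j))}"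

definition tuple_scale :: "real \<Rightarrow> ('m \<Rightarrow> real \<Rightarrow> real) \<Rightarrow> ('m \<Rightarrow> real \<Rightarrow> real)" where
  "tuple_scale c \<mu> = (\<lambda>i x. c * \<mu> i x)"

interpretation tuple: vector_space "tuple_scale :: real \<Rightarrow> ('m \<Rightarrow> real \<Rightarrow> real) \<Rightarrow> _"
  by unfold_locales (auto simp: tuple_scale_def fun_eq_iff algebra_simps)

end

theory Submission
  imports Defs "HOL-Probability.Distributions"
begin

text \<open>
  Write \<open>\<mu>\<^sup>i = h\<^sup>i \<rho>\<close>, \<open>\<beta> = 2/\<sigma>\<^sup>2\<close>, \<open>L f = \<beta>\<^sup>-\<^sup>1 (\<rho> f')' / \<rho>\<close>, \<open>w\<^sub>j = a\<^sub>j \<alpha>\<^sub>j\<close> with sum \<open>A\<close>, and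
  \<open>m = \<Sum>\<^sub>j w\<^sub>j \<langle>h\<^sup>j, x\<rangle>\<close>.  The linearized system becomes \<open>\<partial>\<^sub>t h\<^sup>i = L f\<^sup>i\<close> with
  \<open>f\<^sup>i = h\<^sup>i - \<beta> m x\<close>.  Criticality says \<open>A \<beta> \<langle>x, x\<rangle> = 1\<close>; for \<open>\<sigma> > \<sigma>\<^sub>c\<close> one has \<open>A \<beta> \<langle>x, x\<rangle> < 1\<close>,
  by continuity and uniqueness of the critical value, because it holds for \<open>\<sigma>\<^sup>2 > 2 A\<close>.
  The energy \<open>\<Sum>\<^sub>i (w\<^sub>i + \<epsilon>) \<parallel>h\<^sup>i\<parallel>\<^sup>2 - \<beta> m\<^sup>2\<close> is then equivalent to the squared norm, and its derivative
  is \<open>2 \<Sum>\<^sub>i (w\<^sub>i + \<epsilon>) \<langle>f\<^sup>i, L f\<^sup>i\<rangle>\<close> up to a term of order \<open>\<epsilon>\<close>, so the Poincare inequality for \<open>\<rho>\<close> gives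
  exponential decay.  The shift by \<open>\<epsilon>\<close> controls the species of weight zero.
  At \<open>\<sigma> = \<sigma>\<^sub>c\<close>, \<open>L f\<^sup>i = 0\<close> with \<open>f\<^sup>i\<close> in \<open>L\<^sup>2(\<rho>)\<close> forces every \<open>f\<^sup>i\<close> to be constant.
\<close>

section \<open>Square-integrable functions\<close>

text \<open>The obstacle is integration by parts. The domain puts only \<open>h\<close> and its
  image under the operator in \<open>L2(rho)\<close>; square integrability of \<open>f'\<close> and
  the decay of boundary terms have to be earned. Beyond a point \<open>x\<close> the flux
  \<open>rho * f'\<close> can change by at most a multiple of \<open>sqrt (rho x)\<close>, so a
  larger flux would stay away from zero and contradict \<open>f\<close> in \<open>L2(rho)\<close>.
  Boundary terms then vanish along suitable radii, which is enough for a dissipation inequality, and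
  the same bound with zero right-hand side settles the kernel.

  The form of the energy comes from a gradient structure: the first variation of
  \<open>sum w_i |h^i|^2 - beta m^2\<close> in \<open>h^i\<close> is \<open>2 w_i f^i\<close>. Hence
  without \<epsilon> its derivative is a sum of dissipation terms with no cross term, although the
  nonlocal operator is in general not symmetric in the plain norm. Subcriticality enters through
  Cauchy-Schwarz, \<open>m^2 <= A v * sum w_i |h^i|^2\<close>. The Poincare inequality applies to
  \<open>f^i\<close> because subtracting a multiple of the odd function \<open>x\<close> preserves
  zero mean.\<close>

definition sq_integrable :: "'a measure \<Rightarrow> ('a \<Rightarrow> real) \<Rightarrow> bool" where
  "sq_integrable M f \<longleftrightarrow> f \<in> borel_measurable M \<and> integrable M (\<lambda>x. (f x)\<^sup>2)"

definition ip :: "'a measure \<Rightarrow> ('a \<Rightarrow> real) \<Rightarrow> ('a \<Rightarrow> real) \<Rightarrow> real" where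
  "ip M f g = (\<integral>x. f x * g x \<partial>M)"

lemma sq_integrable_measurable [measurable_dest]:
  "sq_integrable M f \<Longrightarrow> f \<in> borel_measurable M"
  by (simp add: sq_integrable_def)

lemma sq_integrable_mult:
  assumes "sq_integrable M f" "sq_integrable M g"
  shows "integrable M (\<lambda>x. f x * g x)"
proof (rule Bochner_Integration.integrable_bound)
  show "integrable M (\<lambda>x. (f x)\<^sup>2 + (g x)\<^sup>2)"
    using assms by (simp add: sq_integrable_def)
  note [measurable] = assms[THEN sq_integrable_measurable]
  show "(\<lambda>x. f x * g x) \<in> borel_measurable M"
    by measurable
  have "\<bar>u * v\<bar> \<le> u\<^sup>2 + v\<^sup>2" for u v :: real
  proof -
    have "0 \<le> (\<bar>u\<bar> - \<bar>v\<bar>)\<^sup>2" by simp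
    then have "2 * \<bar>u * v\<bar> \<le> u\<^sup>2 + v\<^sup>2"
      by (simp add: power2_eq_square algebra_simps abs_mult)
    then show ?thesis by linarith
  qed
  then show "AE x in M. norm (f x * g x) \<le> norm ((f x)\<^sup>2 + (g x)\<^sup>2)"
    by simp
qed

lemma sq_integrable_scale: "sq_integrable M f \<Longrightarrow> sq_integrable M (\<lambda>x. c * f x)"
  by (auto simp: sq_integrable_def power_mult_distrib)

lemma sq_integrable_add:
  assumes "sq_integrable M f" "sq_integrable M g"
  shows "sq_integrable M (\<lambda>x. f x + g x)"
  using assms sq_integrable_mult[OF assms]
  by (auto simp: sq_integrable_def power2_sum mult.assoc)

lemma sq_integrable_diff:
  assumes "sq_integrable M f" "sq_integrable M g"
  shows "sq_integrable M (\<lambda>x. f x - g x)"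
  using sq_integrable_add[OF assms(1) sq_integrable_scale[OF assms(2), of "-1"]] by simp

lemma ip_commute: "ip M f g = ip M g f"
  by (simp add: ip_def mult.commute)

lemma ip_self_nonneg: "0 \<le> ip M f f"
  by (simp add: ip_def)

lemma ip_scale_left: "ip M (\<lambda>x. c * f x) g = c * ip M f g"
  by (simp add: ip_def mult.assoc)

lemma ip_scale_right: "ip M f (\<lambda>x. c * g x) = c * ip M f g"
  by (metis ip_commute ip_scale_left)

lemma ip_add_left:
  assumes "sq_integrable M f" "sq_integrable M g" "sq_integrable M h"
  shows "ip M (\<lambda>x. f x + g x) h = ip M f h + ip M g h"
  using assms by (simp add: ip_def distrib_right sq_integrable_mult)

lemma ip_add_right:
  assumes "sq_integrable M f" "sq_integrable M g" "sq_integrable M h"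
  shows "ip M h (\<lambda>x. f x + g x) = ip M h f + ip M h g"
  using ip_add_left[OF assms] by (simp add: ip_commute)

lemma ip_diff_left:
  assumes "sq_integrable M f" "sq_integrable M g" "sq_integrable M h"
  shows "ip M (\<lambda>x. f x - g x) h = ip M f h - ip M g h"
  using assms by (simp add: ip_def left_diff_distrib sq_integrable_mult)

lemma ip_self_add:
  assumes "sq_integrable M f" "sq_integrable M g"
  shows "ip M (\<lambda>x. f x + g x) (\<lambda>x. f x + g x) = ip M f f + 2 * ip M f g + ip M g g"
  using assms
  by (simp add: ip_add_left ip_add_right sq_integrable_add ip_commute[of M g f])

lemma ip_self_add_scale:
  assumes "sq_integrable M f" "sq_integrable M g"
  shows "ip M (\<lambda>x. f x + t * g x) (\<lambda>x. f x + t * g x) = ip M f f + 2 * t * ip M f g + t\<^sup>2 * ip M g g"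
  using ip_self_add[OF assms(1) sq_integrable_scale[OF assms(2), of t]]
  by (simp add: ip_scale_left ip_scale_right power2_eq_square)

text \<open>A discriminant argument for the nonnegative polynomial in \<open>t\<close> given by the
  square of \<open>f + t g\<close>. The form is only semidefinite on functions, so a degenerate
  \<open>g\<close> is treated separately.\<close>

lemma ip_Cauchy_Schwarz:
  assumes f: "sq_integrable M f" and g: "sq_integrable M g"
  shows "(ip M f g)\<^sup>2 \<le> ip M f f * ip M g g"
proof -
  have nonneg: "0 \<le> ip M f f + 2 * t * ip M f g + t\<^sup>2 * ip M g g" for t
    using ip_self_nonneg[of M "\<lambda>x. f x + t * g x"] ip_self_add_scale[OF f g, of t] by simp
  show ?thesis
  proof (cases "ip M g g = 0")
    case True
    have "ip M f g = 0"
    proof (rule ccontr)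
      assume "ip M f g \<noteq> 0"
      \<comment> \<open>When the quadratic term vanishes the polynomial is affine; at this
        \<open>t\<close> it would equal -1.\<close>
      then have "2 * (- (ip M f f + 1) / (2 * ip M f g)) * ip M f g = - (ip M f f + 1)"
        by simp
      then show False
        using nonneg[of "- (ip M f f + 1) / (2 * ip M f g)"] True by simp
    qed
    then show ?thesis by (simp add: True)
  next
    case False
    then have "0 < ip M g g" using ip_self_nonneg[of M g] by simp
    moreover from this have "0 \<le> ip M f f - (ip M f g)\<^sup>2 / ip M g g"
      using nonneg[of "- ip M f g / ip M g g"] by (simp add: power2_eq_square)
    ultimately show ?thesis
      by (simp add: pos_divide_le_eq)
  qed
qed

lemma ip_abs_le:
  assumes "sq_integrable M f" "sq_integrable M g"
  shows "\<bar>ip M f g\<bar> \<le> sqrt (ip M f f) * sqrt (ip M g g)"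
  using real_sqrt_le_mono[OF ip_Cauchy_Schwarz[OF assms]] by (simp add: real_sqrt_mult)

lemma ip_self_add_le:
  assumes f: "sq_integrable M f" and g: "sq_integrable M g"
  shows "ip M (\<lambda>x. f x + g x) (\<lambda>x. f x + g x) \<le> 2 * ip M f f + 2 * ip M g g"
proof -
  have "0 \<le> ip M f f - 2 * ip M f g + ip M g g"
    using ip_self_nonneg[of M "\<lambda>x. f x + (-1) * g x"] ip_self_add_scale[OF f g, of "-1"] by simp
  then show ?thesis using ip_self_add[OF f g] by simp
qed

lemma tendsto_ip_zero:
  assumes u: "\<forall>\<^sub>F r in F. sq_integrable M (u r)" and v: "sq_integrable M v"
    and lim: "((\<lambda>r. ip M (u r) (u r)) \<longlongrightarrow> 0) F"
  shows "((\<lambda>r. ip M (u r) v) \<longlongrightarrow> 0) F"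
proof (rule Lim_null_comparison)
  show "\<forall>\<^sub>F r in F. norm (ip M (u r) v) \<le> sqrt (ip M (u r) (u r)) * sqrt (ip M v v)"
    using u by eventually_elim (use v ip_abs_le in auto)
  show "((\<lambda>r. sqrt (ip M (u r) (u r)) * sqrt (ip M v v)) \<longlongrightarrow> 0) F"
    using tendsto_mult_right[OF tendsto_real_sqrt[OF lim]] by (metis mult_zero_left real_sqrt_zero)
qed

lemma tendsto_ip_curve:
  assumes h: "\<forall>\<^sub>F r in F. sq_integrable M (h r)" and h0: "sq_integrable M h0"
    and v: "sq_integrable M v"
    and lim: "((\<lambda>r. ip M (\<lambda>x. h r x - h0 x) (\<lambda>x. h r x - h0 x)) \<longlongrightarrow> 0) F"
  shows "((\<lambda>r. ip M (h r) v) \<longlongrightarrow> ip M h0 v) F"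
    and "((\<lambda>r. ip M (h r) (h r)) \<longlongrightarrow> ip M h0 h0) F"
proof -
  have d: "\<forall>\<^sub>F r in F. sq_integrable M (\<lambda>x. h r x - h0 x)"
    using h by eventually_elim (use h0 sq_integrable_diff in auto)
  have "((\<lambda>r. ip M (\<lambda>x. h r x - h0 x) v + ip M h0 v) \<longlongrightarrow> 0 + ip M h0 v) F"
    by (intro tendsto_add tendsto_ip_zero[OF d v lim] tendsto_const)
  moreover have "\<forall>\<^sub>F r in F. ip M (\<lambda>x. h r x - h0 x) v + ip M h0 v = ip M (h r) v"
    using h by eventually_elim (use h0 v in \<open>simp add: ip_diff_left\<close>)
  ultimately show "((\<lambda>r. ip M (h r) v) \<longlongrightarrow> ip M h0 v) F"
    by (simp add: tendsto_cong)
  have "((\<lambda>r. ip M h0 h0 + 2 * ip M (\<lambda>x. h r x - h0 x) h0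
              + ip M (\<lambda>x. h r x - h0 x) (\<lambda>x. h r x - h0 x)) \<longlongrightarrow> ip M h0 h0 + 2 * 0 + 0) F"
    by (intro tendsto_intros tendsto_ip_zero[OF d h0 lim] lim)
  moreover have "\<forall>\<^sub>F r in F. ip M h0 h0 + 2 * ip M (\<lambda>x. h r x - h0 x) h0
      + ip M (\<lambda>x. h r x - h0 x) (\<lambda>x. h r x - h0 x) = ip M (h r) (h r)"
    using d
  proof eventually_elim
    case (elim r)
    show ?case using ip_self_add[OF h0 elim] by (simp add: ip_commute)
  qed
  ultimately show "((\<lambda>r. ip M (h r) (h r)) \<longlongrightarrow> ip M h0 h0) F"
    by (simp add: tendsto_cong)
qed

text \<open>Norm differentiability means \<open>h r = h t + (r - t) * (k + d r)\<close> with
  \<open>d r\<close> tending to zero in norm. Inserting this turns both difference quotients into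
  exact expressions whose error terms are pairings with \<open>d r\<close> or carry a factor
  \<open>r - t\<close>. Square integrability is asked only near \<open>t\<close>, since solutions
  live on nonnegative times.\<close>

lemma has_derivative_ip_curve:
  fixes h :: "real \<Rightarrow> 'a \<Rightarrow> real"
  assumes h: "\<forall>\<^sub>F r in at t. sq_integrable M (h r)" and ht: "sq_integrable M (h t)"
    and k: "sq_integrable M k" and v: "sq_integrable M v"
    and lim: "((\<lambda>r. ip M (\<lambda>x. (h r x - h t x) / (r - t) - k x)
                         (\<lambda>x. (h r x - h t x) / (r - t) - k x)) \<longlongrightarrow> 0) (at t)"
  shows "((\<lambda>r. ip M (h r) v) has_real_derivative ip M k v) (at t)"
    and "((\<lambda>r. ip M (h r) (h r)) has_real_derivative 2 * ip M (h t) k) (at t)"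
proof -
  define d where "d r = (\<lambda>x. (h r x - h t x) / (r - t) - k x)" for r
  have q: "\<forall>\<^sub>F r in at t. r \<noteq> t"
    by (simp add: eventually_at_filter)
  have d: "\<forall>\<^sub>F r in at t. sq_integrable M (d r)"
    using h
  proof eventually_elim
    case (elim r)
    show ?case
      using sq_integrable_diff[OF sq_integrable_scale[OF sq_integrable_diff[OF elim ht], of "1/(r-t)"] k]
      by (simp add: d_def)
  qed
  have lim': "((\<lambda>r. ip M (d r) (d r)) \<longlongrightarrow> 0) (at t)" using lim by (simp add: d_def)
  have hr: "h r = (\<lambda>x. h t x + (r - t) * (k x + d r x))" if "r \<noteq> t" for r
    using that by (auto simp: d_def)
  have rt: "((\<lambda>r. r - t) \<longlongrightarrow> 0) (at t)"
    by (rule LIM_zero) simp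
  show "((\<lambda>r. ip M (h r) v) has_real_derivative ip M k v) (at t)"
    unfolding has_field_derivative_iff
  proof (rule Lim_transform_eventually)
    show "((\<lambda>r. ip M k v + ip M (d r) v) \<longlongrightarrow> ip M k v) (at t)"
      using tendsto_add[OF tendsto_const tendsto_ip_zero[OF d v lim'], of "ip M k v"] by simp
    show "\<forall>\<^sub>F r in at t. ip M k v + ip M (d r) v = (ip M (h r) v - ip M (h t) v) / (r - t)"
      using d q
    proof eventually_elim
      case (elim r)
      note kd = sq_integrable_add[OF k elim(1)]
      show ?case
        using elim ip_add_left[OF ht sq_integrable_scale[OF kd, of "r - t"] v]
          ip_add_left[OF k elim(1) v]
        by (simp add: hr[OF elim(2)] ip_scale_left)
    qed
  qed
  show "((\<lambda>r. ip M (h r) (h r)) has_real_derivative 2 * ip M (h t) k) (at t)"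
    unfolding has_field_derivative_iff
  proof (rule Lim_transform_eventually)
    have "((\<lambda>r. 2 * (ip M (h t) k + ip M (d r) (h t))
        + (r - t) * (ip M k k + 2 * ip M (d r) k + ip M (d r) (d r)))
        \<longlongrightarrow> 2 * (ip M (h t) k + 0) + 0 * (ip M k k + 2 * 0 + 0)) (at t)"
      by (intro tendsto_intros tendsto_ip_zero[OF d _ lim'] rt lim' ht k)
    then show "((\<lambda>r. 2 * (ip M (h t) k + ip M (d r) (h t))
        + (r - t) * (ip M k k + 2 * ip M (d r) k + ip M (d r) (d r)))
        \<longlongrightarrow> 2 * ip M (h t) k) (at t)"
      by simp
    show "\<forall>\<^sub>F r in at t. 2 * (ip M (h t) k + ip M (d r) (h t))
        + (r - t) * (ip M k k + 2 * ip M (d r) k + ip M (d r) (d r))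
        = (ip M (h r) (h r) - ip M (h t) (h t)) / (r - t)"
      using d q
    proof eventually_elim
      case (elim r)
      note kd = sq_integrable_add[OF k elim(1)]
      have "ip M (h r) (h r) = ip M (h t) (h t) + 2 * (r - t) * ip M (h t) (\<lambda>x. k x + d r x)
          + (r - t)\<^sup>2 * ip M (\<lambda>x. k x + d r x) (\<lambda>x. k x + d r x)"
        using ip_self_add_scale[OF ht kd, of "r - t"] by (simp add: hr[OF elim(2)])
      then show ?case
        using elim ip_self_add[OF k elim(1)] ip_add_right[OF k elim(1) ht]
        by (simp add: power2_eq_square ip_commute[of M "d r" k] ip_commute[of M "d r" "h t"] field_simps)
    qed
  qed
qed

section \<open>Integrals over bounded intervals and their limits\<close>

lemma set_lebesgue_integral_FTC:
  fixes F g :: "real \<Rightarrow> real"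
  assumes "a \<le> b" and "\<And>x. a \<le> x \<Longrightarrow> x \<le> b \<Longrightarrow> (F has_real_derivative g x) (at x within {a..b})"
    and "set_integrable lborel {a..b} g"
  shows "(LINT x:{a..b}|lborel. g x) = F b - F a"
proof -
  \<comment> \<open>The gauge integral needs no continuity of the derivative. This matters because
    the derivative of the flux contains \<open>k\<close>, which is known only to be square
    integrable.\<close>
  have "(g has_integral (F b - F a)) {a..b}"
    using assms(1,2)
    by (intro fundamental_theorem_of_calculus)
       (auto simp: has_real_derivative_iff_has_vector_derivative[symmetric])
  then show ?thesis
    using set_borel_integral_eq_integral(2)[OF assms(3)] by (simp add: integral_unique)
qed

lemma set_integrable_Icc:
  fixes g :: "real \<Rightarrow> real"
  shows "integrable lborel g \<Longrightarrow> set_integrable lborel {a..b} g"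
  by (simp add: set_integrable_def integrable_mult_indicator del: real_scaleR_def)

lemma set_lebesgue_integral_symmetric:
  fixes g :: "real \<Rightarrow> real"
  assumes "continuous_on UNIV g" "0 \<le> R"
  shows "(LINT x:{-R..R}|lborel. g x) = (LINT x:{0..R}|lborel. g x) + (LINT x:{0..R}|lborel. g (- x))"
proof -
  have g: "continuous_on S g" for S using assms(1) continuous_on_subset by blast
  have g': "continuous_on S (\<lambda>x. g (- x))" for S
    by (intro continuous_on_compose2[OF assms(1)] continuous_intros) auto
  have "integral {-R..R} g = integral {-R..0} g + integral {0..R} g"
    using assms(2) by (intro Henstock_Kurzweil_Integration.integral_combine[symmetric]
      integrable_continuous_interval g) auto
  also have "integral {-R..0} g = integral {0..R} (\<lambda>x. g (- x))"
    using Henstock_Kurzweil_Integration.integral_reflect_real[of R 0 "\<lambda>x. g (- x)"] by simp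
  finally show ?thesis
    by (simp add: set_borel_integral_eq_integral borel_integrable_atLeastAtMost' g g')
qed

lemma tendsto_integral_symmetric:
  fixes g :: "real \<Rightarrow> real"
  assumes g: "integrable lborel g"
  shows "((\<lambda>R. LINT x:{-R..R}|lborel. g x) \<longlongrightarrow> (\<integral>x. g x \<partial>lborel)) at_top"
  unfolding set_lebesgue_integral_def
proof (rule integral_dominated_convergence_at_top)
  show "integrable lborel (\<lambda>x. norm (g x))" using g by simp
  show "\<forall>\<^sub>F R in at_top. AE x in lborel. norm (indicat_real {-R..R} x *\<^sub>R g x) \<le> norm (g x)"
    by (intro always_eventually allI AE_I2) (auto split: split_indicator)
  show "AE x in lborel. ((\<lambda>R. indicat_real {-R..R} x *\<^sub>R g x) \<longlongrightarrow> g x) at_top"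
  proof (intro AE_I2 tendsto_eventually)
    fix x :: real
    show "\<forall>\<^sub>F R in at_top. indicat_real {-R..R} x *\<^sub>R g x = g x"
      using eventually_ge_at_top[of "\<bar>x\<bar>"] by eventually_elim (auto split: split_indicator)
  qed
qed (use g in auto)

text \<open>An integrable function need not tend to zero, but it is small at arbitrarily distant
  points. This supplies the radii at which boundary terms are negligible.\<close>

lemma integrable_frequently_small:
  fixes g :: "real \<Rightarrow> real"
  assumes g: "integrable lborel g" and "\<And>x. 0 \<le> g x" and "0 < c"
  obtains R where "N \<le> R" "g R \<le> c"
proof -
  have "\<exists>R\<ge>N. g R \<le> c"
  proof (rule ccontr)
    assume "\<not> ?thesis"
    then have gc: "c < g x" if "N \<le> x" for x using that by force
    have le: "c * (R - N) \<le> (\<integral>x. g x \<partial>lborel)" if "N \<le> R" for R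
    proof -
      have "c * (R - N) = (\<integral>x. c * indicator {N..R} x \<partial>lborel)"
        using that by simp
      also have "\<dots> \<le> (\<integral>x. g x \<partial>lborel)"
      proof (rule integral_mono)
        show "integrable lborel (\<lambda>x. c * indicat_real {N..R} x)"
          by (intro integrable_mult_right integrable_real_indicator) (auto simp: emeasure_lborel_Icc_eq)
        show "c * indicat_real {N..R} x \<le> g x" for x
          using gc[of x] assms(2)[of x] by (auto split: split_indicator)
      qed fact
      finally show ?thesis .
    qed
    \<comment> \<open>Chosen so that \<open>c * (R - N)\<close> exceeds the integral by exactly
      1.\<close>
    define R where "R = N + ((\<integral>x. g x \<partial>lborel) + 1) / c"
    have "0 \<le> (\<integral>x. g x \<partial>lborel)" using assms(2) by simp
    then have "N \<le> R" using \<open>0 < c\<close> by (simp add: R_def)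
    from le[OF this] show False using \<open>0 < c\<close> by (simp add: R_def)
  qed
  then show ?thesis using that by blast
qed

section \<open>The Gibbs density of the quartic potential\<close>

lemma Vbar0_ge: 
  assumes "0 \<le> A"
  shows "x ^ 4 / 4 - x\<^sup>2 / 2 \<le> Vbar0 A x"
  using assms by (simp add: Vbar0_def Vbar_def)

lemma gibbs_weight_pos: "0 < gibbs_weight A s x"
  by (simp add: gibbs_weight_def)

lemma gibbs_weight_measurable [measurable]: "gibbs_weight A s \<in> borel_measurable borel"
  unfolding gibbs_weight_def[abs_def] Vbar0_def Vbar_def by measurable

lemma quartic_lower_bound: "- b\<^sup>2 \<le> (x::real) ^ 4 / 4 - b * x\<^sup>2"
proof -
  have "0 \<le> (x\<^sup>2 / 2 - b)\<^sup>2" by simp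
  then show ?thesis by (simp add: power2_eq_square algebra_simps power4_eq_xxxx)
qed

lemma gibbs_weight_le:
  assumes "0 \<le> A" "0 < s"
  obtains K where "0 < K" "\<And>x. gibbs_weight A s x \<le> K * exp (- x\<^sup>2 / 2)"
proof
  \<comment> \<open>Splitting off \<open>s\<^sup>2 / 4 * x\<^sup>2\<close> from the quartic leaves
    \<open>x ^ 4 / 4 - b * x\<^sup>2\<close>. After multiplication by \<open>2 / s\<^sup>2\<close>
    the split-off part is \<open>x\<^sup>2 / 2\<close>, the exponent of the standard
    Gaussian.\<close>
  define b where "b = 1 / 2 + s\<^sup>2 / 4"
  fix x
  have "x\<^sup>2 / 2 - 2 / s\<^sup>2 * b\<^sup>2 = 2 / s\<^sup>2 * (s\<^sup>2 / 4 * x\<^sup>2 - b\<^sup>2)"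
    using assms by (simp add: right_diff_distrib)
  also have "\<dots> \<le> 2 / s\<^sup>2 * Vbar0 A x"
    using quartic_lower_bound[of b x] Vbar0_ge[OF assms(1), of x]
    by (intro mult_left_mono) (simp_all add: b_def algebra_simps)
  finally have "- (2 / s\<^sup>2) * Vbar0 A x \<le> 2 / s\<^sup>2 * b\<^sup>2 + (- x\<^sup>2 / 2)" by simp
  then show "gibbs_weight A s x \<le> exp (2 / s\<^sup>2 * b\<^sup>2) * exp (- x\<^sup>2 / 2)"
    unfolding gibbs_weight_def exp_add[symmetric] by simp
qed simp

lemma integrable_gaussian_moment:
  fixes g :: "real \<Rightarrow> real"
  assumes [measurable]: "g \<in> borel_measurable borel" and "\<And>x. \<bar>g x\<bar> \<le> K * exp (- x\<^sup>2 / 2)"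
  shows "integrable lborel (\<lambda>x. x ^ n * g x)"
proof (rule Bochner_Integration.integrable_bound)
  show "integrable lborel (\<lambda>x. K * sqrt (2 * pi) * (std_normal_density x * \<bar>x\<bar> ^ n))"
    by (intro integrable_mult_right integrable_std_normal_moment_abs)
  have "\<bar>x ^ n * g x\<bar> \<le> \<bar>K * sqrt (2 * pi) * (std_normal_density x * \<bar>x\<bar> ^ n)\<bar>" for x
  proof -
    have "\<bar>x ^ n * g x\<bar> \<le> \<bar>x\<bar> ^ n * (K * exp (- x\<^sup>2 / 2))"
      using assms(2)[of x] by (auto simp: abs_mult power_abs intro: mult_left_mono)
    also have "\<dots> = K * sqrt (2 * pi) * (std_normal_density x * \<bar>x\<bar> ^ n)"
      by (simp add: std_normal_density_def)
    finally show ?thesis by linarith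
  qed
  then show "AE x in lborel. norm (x ^ n * g x)
      \<le> norm (K * sqrt (2 * pi) * (std_normal_density x * \<bar>x\<bar> ^ n))"
    by simp
qed auto

lemma integrable_gibbs_weight_moment:
  assumes "0 \<le> A" "0 < s"
  shows "integrable lborel (\<lambda>x. x ^ n * gibbs_weight A s x)"
proof -
  obtain K where "\<And>x. gibbs_weight A s x \<le> K * exp (- x\<^sup>2 / 2)"
    using gibbs_weight_le[OF assms] by blast
  then show ?thesis
    by (intro integrable_gaussian_moment[where K = K]) (simp_all add: gibbs_weight_pos less_imp_le)
qed

locale quartic_gibbs =
  fixes A s :: real
  assumes A_pos: "0 < A" and s_pos: "0 < s"
begin

definition beta :: real where "beta = 2 / s\<^sup>2"

text \<open>The derivative of \<open>Vbar0 A\<close>, so that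
  \<open>rho' = - beta * dU * rho\<close>.\<close>

definition dU :: "real \<Rightarrow> real" where "dU x = x ^ 3 + (A - 1) * x"

abbreviation rho :: "real \<Rightarrow> real" where "rho \<equiv> gibbs A s"

definition Z :: real where "Z = (\<integral>y. gibbs_weight A s y \<partial>lborel)"

abbreviation nu :: "real measure" where "nu \<equiv> density lborel (\<lambda>x. ennreal (rho x))"

lemma beta_pos: "0 < beta"
  using s_pos by (simp add: beta_def)

lemma Z_pos: "0 < Z"
proof -
  \<comment> \<open>On the unit interval the potential is at most \<open>1 / 4 + A / 2\<close>, the
    negative quadratic term being dropped.\<close>
  define c where "c = exp (- beta * (1 / 4 + A / 2))"
  have "c = (\<integral>x. c * indicator {0..1::real} x \<partial>lborel)" by simp
  also have "\<dots> \<le> Z"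
    unfolding Z_def
  proof (rule integral_mono)
    show "integrable lborel (\<lambda>x. c * indicat_real {0..1::real} x)"
      by (intro integrable_mult_right integrable_real_indicator) auto
    show "integrable lborel (gibbs_weight A s)"
      using integrable_gibbs_weight_moment[of A s 0] A_pos s_pos by simp
    fix x
    have "c \<le> gibbs_weight A s x" if "0 \<le> x" "x \<le> 1"
    proof -
      have "x ^ 4 \<le> 1" "x\<^sup>2 \<le> 1" using that by (simp_all add: power_le_one)
      moreover from this have "A / 2 * x\<^sup>2 \<le> A / 2 * 1"
        using A_pos by (intro mult_left_mono) auto
      ultimately have "Vbar0 A x \<le> 1 / 4 + A / 2"
        using zero_le_power2[of x] unfolding Vbar0_def Vbar_def by linarith
      then show ?thesis
        using beta_pos by (simp add: c_def gibbs_weight_def beta_def divide_right_mono)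
    qed
    then show "c * indicat_real {0..1::real} x \<le> gibbs_weight A s x"
      using gibbs_weight_pos[of A s x] by (auto split: split_indicator)
  qed
  finally show ?thesis using exp_gt_zero[of "- beta * (1 / 4 + A / 2)"] unfolding c_def by linarith
qed

lemma rho_eq: "rho x = gibbs_weight A s x / Z"
  by (simp add: gibbs_def Z_def)

lemma rho_pos: "0 < rho x"
  using Z_pos by (simp add: rho_eq gibbs_weight_pos)

lemma rho_nonneg [simp]: "0 \<le> rho x"
  using rho_pos[of x] by simp

lemma rho_neq_0 [simp]: "rho x \<noteq> 0"
  using rho_pos[of x] by simp

lemma rho_minus [simp]: "rho (- x) = rho x"
  by (simp add: rho_eq gibbs_weight_def Vbar0_def Vbar_def)

lemma rho_measurable [measurable]: "rho \<in> borel_measurable borel"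
  unfolding rho_eq[abs_def] by measurable

lemma DERIV_rho [derivative_intros]:
  "(rho has_real_derivative - beta * dU x * rho x) (at x)"
  unfolding rho_eq[abs_def] gibbs_weight_def[abs_def] Vbar0_def Vbar_def beta_def dU_def
  using s_pos Z_pos
  by (auto intro!: derivative_eq_intros simp: field_simps power3_eq_cube power2_eq_square)

lemma integrable_rho_moment: "integrable lborel (\<lambda>x. x ^ n * rho x)"
  using integrable_gibbs_weight_moment[of A s n] A_pos s_pos by (simp add: rho_eq)

lemma integrable_rho: "integrable lborel rho"
  using integrable_rho_moment[of 0] by simp

lemma integral_rho: "(\<integral>x. rho x \<partial>lborel) = 1"
  using Z_pos by (simp add: rho_eq Z_def[symmetric])

lemma integral_odd_rho: "(\<integral>x. x * rho x \<partial>lborel) = 0"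
  using lborel_integral_real_affine[of "-1" "\<lambda>x. x * rho x" 0] by simp

lemma sq_integrable_nu:
  "sq_integrable nu f \<longleftrightarrow> f \<in> borel_measurable borel \<and> integrable lborel (\<lambda>x. (f x)\<^sup>2 * rho x)"
proof -
  have "integrable nu (\<lambda>x. (f x)\<^sup>2) \<longleftrightarrow> integrable lborel (\<lambda>x. rho x * (f x)\<^sup>2)"
    if [measurable]: "f \<in> borel_measurable borel"
    by (rule integrable_real_density) auto
  then show ?thesis by (auto simp: sq_integrable_def mult.commute)
qed

lemma ip_nu:
  assumes "f \<in> borel_measurable borel" "g \<in> borel_measurable borel"
  shows "ip nu f g = (\<integral>x. f x * g x * rho x \<partial>lborel)"
proof -
  note [measurable] = assms
  have "ip nu f g = (\<integral>x. rho x * (f x * g x) \<partial>lborel)"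
    unfolding ip_def by (rule integral_real_density) auto
  then show ?thesis by (simp add: mult.commute)
qed

lemma integrable_nu_mult:
  assumes "sq_integrable nu f" "sq_integrable nu g"
  shows "integrable lborel (\<lambda>x. f x * g x * rho x)"
proof -
  have [measurable]: "f \<in> borel_measurable borel" "g \<in> borel_measurable borel"
    using assms by (auto simp: sq_integrable_nu)
  have "integrable nu (\<lambda>x. f x * g x)" by (rule sq_integrable_mult[OF assms])
  then have "integrable lborel (\<lambda>x. rho x * (f x * g x))"
    by (subst (asm) integrable_real_density) auto
  then show ?thesis by (simp add: mult.commute)
qed

lemma sq_integrable_power: "sq_integrable nu (\<lambda>x. x ^ n)"
  using integrable_rho_moment[of "n * 2"] by (auto simp: sq_integrable_nu power_mult)

lemma sq_integrable_id: "sq_integrable nu (\<lambda>x. x)"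
  using sq_integrable_power[of 1] by simp

lemma sq_integrable_const: "sq_integrable nu (\<lambda>x. c)"
  using sq_integrable_scale[OF sq_integrable_power[of 0], of c] by simp

lemma sq_integrable_dU: "sq_integrable nu dU"
  unfolding dU_def[abs_def]
  by (intro sq_integrable_add sq_integrable_power sq_integrable_scale sq_integrable_id)

lemma ip_one_one: "ip nu (\<lambda>x. 1) (\<lambda>x. 1) = 1"
  by (simp add: ip_nu integral_rho)

lemma ip_id_one: "ip nu (\<lambda>x. x) (\<lambda>x. 1) = 0"
  by (simp add: ip_nu integral_odd_rho)

text \<open>The variance of the Gibbs measure, whose mean is zero; the critical equation compares it
  with \<open>1 / (A * beta)\<close>.\<close>

definition v :: real where "v = ip nu (\<lambda>x. x) (\<lambda>x. x)"

lemma critical_equation_iff: "critical_equation A s \<longleftrightarrow> A * beta * v = 1"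
proof -
  have "v = (\<integral>x. x\<^sup>2 * gibbs_weight A s x \<partial>lborel) / Z"
    by (simp add: v_def ip_nu) (simp add: rho_eq power2_eq_square)
  then have "critical_equation A s \<longleftrightarrow> v = s\<^sup>2 / (2 * A)"
    by (simp add: critical_equation_def Z_def)
  also have "\<dots> \<longleftrightarrow> A * beta * v = 1"
    using A_pos s_pos by (auto simp: beta_def field_simps)
  finally show ?thesis .
qed

section \<open>Pointwise and tail bounds for the Gibbs density\<close>

lemma dU_rho_bound: obtains K where "0 < K" "\<And>x. \<bar>dU x\<bar> * sqrt (rho x) \<le> K"
proof -
  obtain K where K: "0 < K" "\<And>x. gibbs_weight A s x \<le> K * exp (- x\<^sup>2 / 2)"
    using gibbs_weight_le[of A s] A_pos s_pos by auto
  \<comment> \<open>From \<open>(p + q)\<^sup>2 \<le> 2 * p\<^sup>2 + 2 * q\<^sup>2\<close> applied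
    to \<open>dU\<close>, followed by \<open>x\<^sup>2 \<le> 1 + x ^ 6\<close>.\<close>
  define c where "c = 2 + 2 * (A - 1)\<^sup>2"
  have c: "0 < c" unfolding c_def by (simp add: add_pos_nonneg)
  have b: "(dU x)\<^sup>2 * rho x \<le> c * 217 * (K / Z)" for x
  proof -
    have "0 \<le> (x ^ 3 - (A - 1) * x)\<^sup>2" by simp
    then have "(dU x)\<^sup>2 \<le> 2 * x ^ 6 + 2 * (A - 1)\<^sup>2 * x\<^sup>2"
      by (simp add: dU_def power2_eq_square power3_eq_cube eval_nat_numeral algebra_simps)
    also have "x\<^sup>2 \<le> 1 + x ^ 6"
    proof (cases "x\<^sup>2 \<le> 1")
      case False
      then have "x\<^sup>2 ^ 1 \<le> x\<^sup>2 ^ 3" by (intro power_increasing) auto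
      then show ?thesis by (simp add: power_mult[symmetric])
    qed (simp add: add_increasing2)
    then have "2 * x ^ 6 + 2 * (A - 1)\<^sup>2 * x\<^sup>2 \<le> 2 * x ^ 6 + 2 * (A - 1)\<^sup>2 * (1 + x ^ 6)"
      by (intro add_left_mono mult_left_mono) auto
    also have "\<dots> \<le> c * (1 + x ^ 6)" by (simp add: c_def algebra_simps)
    finally have 1: "(dU x)\<^sup>2 \<le> c * (1 + x ^ 6)" .
    \<comment> \<open>The cube of \<open>y \<le> exp y\<close> at \<open>y = x\<^sup>2 / 6\<close>
      gives the factor \<open>6 ^ 3 = 216\<close>; one more unit absorbs the constant term. The
      factor \<open>exp (x\<^sup>2 / 2)\<close> then cancels against the Gaussian bound on
      \<open>rho\<close>.\<close>
    have "x\<^sup>2 / 6 \<le> exp (x\<^sup>2 / 6)" using exp_ge_add_one_self[of "x\<^sup>2 / 6"] by linarith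
    then have "(x\<^sup>2 / 6) ^ 3 \<le> exp (x\<^sup>2 / 6) ^ 3" by (intro power_mono) auto
    also have "\<dots> = exp (x\<^sup>2 / 2)" by (simp add: exp_of_nat_mult[symmetric])
    finally have "x ^ 6 \<le> 216 * exp (x\<^sup>2 / 2)"
      by (simp add: power_divide power_mult[symmetric])
    then have "1 + x ^ 6 \<le> 217 * exp (x\<^sup>2 / 2)"
      using one_le_exp_iff[of "x\<^sup>2 / 2"] zero_le_power2[of x] by linarith
    then have "c * (1 + x ^ 6) \<le> c * (217 * exp (x\<^sup>2 / 2))"
      using c by (intro mult_left_mono) auto
    with 1 have 2: "(dU x)\<^sup>2 \<le> c * 217 * exp (x\<^sup>2 / 2)" by simp
    have "rho x \<le> K / Z * exp (- x\<^sup>2 / 2)"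
      using K(2)[of x] Z_pos by (simp add: rho_eq divide_right_mono)
    with 2 have "(dU x)\<^sup>2 * rho x \<le> (c * 217 * exp (x\<^sup>2 / 2)) * (K / Z * exp (- x\<^sup>2 / 2))"
      using c by (intro mult_mono) auto
    also have "\<dots> = c * 217 * (K / Z) * (exp (x\<^sup>2 / 2) * exp (- x\<^sup>2 / 2))" by simp
    also have "\<dots> = c * 217 * (K / Z)" by (simp add: exp_add[symmetric] del: exp_minus)
    finally show ?thesis .
  qed
  have "\<bar>dU x\<bar> * sqrt (rho x) \<le> sqrt (c * 217 * (K / Z))" for x
    using real_sqrt_le_mono[OF b[of x]] by (simp add: real_sqrt_mult)
  then show ?thesis using that[of "sqrt (c * 217 * (K / Z))"] c K(1) Z_pos by simp
qed

text \<open>In the expansion of the potential at \<open>x + z\<close> the only mixed term with the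
  wrong sign is \<open>- x * z\<close>, and \<open>x ^ 3 * z + z\<close> absorbs it. The resulting
  factor depends on \<open>z\<close> alone, which makes the tail estimate uniform in
  \<open>x\<close>.\<close>

lemma rho_shift:
  assumes "0 \<le> x" "0 \<le> z"
  shows "rho (x + z) \<le> rho x * exp (- beta * (z ^ 4 / 4 - z\<^sup>2 / 2 - z))"
proof -
  have "x \<le> x ^ 3 + 1"
  proof (cases "x \<le> 1")
    case False
    then show ?thesis using power_increasing[of 1 3 x] by simp
  qed (use assms in \<open>simp add: add_increasing\<close>)
  then have "x * z \<le> (x ^ 3 + 1) * z" using assms by (intro mult_right_mono)
  moreover have "0 \<le> 3 / 2 * (x * z)\<^sup>2 + x * z ^ 3 + A * (x * z) + A / 2 * z\<^sup>2"
    using assms A_pos by simp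
  moreover have "Vbar0 A (x + z) - Vbar0 A x - (z ^ 4 / 4 - z\<^sup>2 / 2 - z)
    = ((x ^ 3 + 1) * z - x * z) + (3 / 2 * (x * z)\<^sup>2 + x * z ^ 3 + A * (x * z) + A / 2 * z\<^sup>2)"
    by (simp add: Vbar0_def Vbar_def field_simps eval_nat_numeral)
  ultimately have "z ^ 4 / 4 - z\<^sup>2 / 2 - z \<le> Vbar0 A (x + z) - Vbar0 A x"
    by linarith
  then have "beta * (z ^ 4 / 4 - z\<^sup>2 / 2 - z) \<le> beta * (Vbar0 A (x + z) - Vbar0 A x)"
    using beta_pos by (intro mult_left_mono) auto
  then have "- beta * Vbar0 A (x + z) \<le> - beta * Vbar0 A x + - beta * (z ^ 4 / 4 - z\<^sup>2 / 2 - z)"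
    by (simp add: algebra_simps)
  then have "gibbs_weight A s (x + z)
      \<le> gibbs_weight A s x * exp (- beta * (z ^ 4 / 4 - z\<^sup>2 / 2 - z))"
    unfolding gibbs_weight_def beta_def exp_add[symmetric] by simp
  then show ?thesis
    using Z_pos by (simp add: rho_eq divide_right_mono)
qed

lemma rho_tail_bound:
  obtains C where "0 < C" "\<And>x R. 0 \<le> x \<Longrightarrow> (LINT y:{x..R}|lborel. rho y) \<le> C * rho x"
proof -
  define G where "G z = exp (- beta * (z ^ 4 / 4 - z\<^sup>2 / 2 - z))" for z :: real
  have [measurable]: "G \<in> borel_measurable borel" unfolding G_def[abs_def] by measurable
  \<comment> \<open>The quadratic coefficients add up to \<open>b\<close>: 1/2 from the potential,
    1/2 from \<open>z \<le> z\<^sup>2 / 2 + 1 / 2\<close>, and \<open>1 / (2 * beta)\<close>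
    reserved for the Gaussian factor.\<close>
  define b where "b = 1 + 1 / (2 * beta)"
  have "\<bar>G z\<bar> \<le> exp (beta * (b\<^sup>2 + 1 / 2)) * exp (- z\<^sup>2 / 2)" for z
  proof -
    have "0 \<le> (z - 1)\<^sup>2" by simp
    then have "z \<le> z\<^sup>2 / 2 + 1 / 2" by (simp add: power2_eq_square algebra_simps)
    then have "z\<^sup>2 / (2 * beta) - b\<^sup>2 - 1 / 2 \<le> z ^ 4 / 4 - z\<^sup>2 / 2 - z"
      using quartic_lower_bound[of b z] by (simp add: b_def algebra_simps)
    then have "beta * (z\<^sup>2 / (2 * beta) - b\<^sup>2 - 1 / 2) \<le> beta * (z ^ 4 / 4 - z\<^sup>2 / 2 - z)"
      using beta_pos by (intro mult_left_mono) auto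
    moreover have "beta * (z\<^sup>2 / (2 * beta) - b\<^sup>2 - 1 / 2) = z\<^sup>2 / 2 - beta * (b\<^sup>2 + 1 / 2)"
      using beta_pos by (simp add: right_diff_distrib distrib_left)
    ultimately show ?thesis
      unfolding G_def exp_add[symmetric] by simp
  qed
  then have G: "integrable lborel G"
    using integrable_gaussian_moment[of G "exp (beta * (b\<^sup>2 + 1 / 2))" 0] by simp
  define C where "C = (\<integral>z. G z \<partial>lborel)"
  have le: "(LINT y:{x..R}|lborel. rho y) \<le> C * rho x" if "0 \<le> x" for x R
  proof -
    have "(LINT y:{x..R}|lborel. rho y) \<le> (\<integral>y. rho x * G (- x + 1 * y) \<partial>lborel)"
      unfolding set_lebesgue_integral_def
    proof (rule integral_mono)
      show "integrable lborel (\<lambda>y. indicat_real {x..R} y *\<^sub>R rho y)"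
        by (rule integrable_mult_indicator) (simp_all add: integrable_rho)
      show "integrable lborel (\<lambda>y. rho x * G (- x + 1 * y))"
        by (intro integrable_mult_right lborel_integrable_real_affine G) auto
      fix y
      show "indicat_real {x..R} y *\<^sub>R rho y \<le> rho x * G (- x + 1 * y)"
      proof (cases "y \<in> {x..R}")
        case True
        then show ?thesis using rho_shift[OF that, of "y - x"] by (simp add: G_def)
      next
        case False
        then show ?thesis by (simp add: G_def)
      qed
    qed
    also have "\<dots> = C * rho x"
      using lborel_integral_real_affine[of 1 G "- x"] by (simp add: C_def mult.commute)
    finally show ?thesis .
  qed
  have "0 \<le> C" by (simp add: C_def G_def)
  then show ?thesis
  \<comment> \<open>Only \<open>0 \<le> C\<close> has been shown; adding 1 makes the constant
    strictly positive.\<close>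
  proof (intro that[of "C + 1"])
    show "(LINT y:{x..R}|lborel. rho y) \<le> (C + 1) * rho x" if "0 \<le> x" for x R
      using le[OF that, of R] rho_nonneg[of x] unfolding distrib_right by linarith
  qed simp
qed

section \<open>The symmetric generator\<close>

text \<open>The triple consists of \<open>f\<close>, its derivative and
  \<open>k = (\<sigma>\<^sup>2/2) (\<rho> f')' / \<rho>\<close>, the value at \<open>f\<close> of the generator that is symmetric in \<open>L\<^sup>2(\<rho>)\<close>.\<close>

definition gen :: "(real \<Rightarrow> real) \<Rightarrow> (real \<Rightarrow> real) \<Rightarrow> (real \<Rightarrow> real) \<Rightarrow> bool" where
  "gen f f' k \<longleftrightarrow>
     (\<forall>x. (f has_real_derivative f' x) (at x)) \<and>
     (\<forall>x. ((\<lambda>x. rho x * f' x) has_real_derivative beta * (rho x * k x)) (at x)) \<and>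
     sq_integrable nu f \<and> sq_integrable nu k"

lemma sq_integrable_reflect:
  assumes "sq_integrable nu f"
  shows "sq_integrable nu (\<lambda>x. f (- x))"
  using assms lborel_integrable_real_affine[of "\<lambda>x. (f x)\<^sup>2 * rho x" "-1" 0]
  by (auto simp: sq_integrable_nu)

lemma ip_reflect:
  assumes [measurable]: "f \<in> borel_measurable borel" "g \<in> borel_measurable borel"
  shows "ip nu (\<lambda>x. f (- x)) (\<lambda>x. g (- x)) = ip nu f g"
  using lborel_integral_real_affine[of "-1" "\<lambda>x. f x * g x * rho x" 0]
  by (simp add: ip_nu)

text \<open>Since \<open>rho\<close> is even, reflection transfers every estimate on the right
  half-line to the left one.\<close>

lemma gen_reflect:
  assumes "gen f f' k"
  shows "gen (\<lambda>x. f (- x)) (\<lambda>x. - f' (- x)) (\<lambda>x. k (- x))"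
proof -
  have m: "(uminus has_real_derivative - 1) (at x)" for x :: real
    by (rule DERIV_minus[OF DERIV_ident])
  have 1: "((\<lambda>x. f (- x)) has_real_derivative - f' (- x)) (at x)" for x
    using assms DERIV_chain2[of f "f' (- x)" uminus x "-1" UNIV] m
    by (simp add: gen_def)
  have "((\<lambda>x. rho (- x) * f' (- x)) has_real_derivative - (beta * (rho (- x) * k (- x)))) (at x)" for x
  proof -
    have "((\<lambda>x. rho x * f' x) has_real_derivative beta * (rho (- x) * k (- x))) (at (- x))"
      using assms unfolding gen_def by blast
    from DERIV_chain2[OF this m] show ?thesis by simp
  qed
  from DERIV_minus[OF this]
  have 2: "((\<lambda>x. rho x * - f' (- x)) has_real_derivative beta * (rho x * k (- x))) (at x)" for x
    by simp
  show ?thesis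
    using assms 1 2 by (simp add: gen_def sq_integrable_reflect)
qed

lemma gen_minus:
  assumes "gen f f' k"
  shows "gen (\<lambda>x. - f x) (\<lambda>x. - f' x) (\<lambda>x. - k x)"
proof -
  have "((\<lambda>x. rho x * - f' x) has_real_derivative beta * (rho x * - k x)) (at x)" for x
    using DERIV_minus[of "\<lambda>x. rho x * f' x" "beta * (rho x * k x)" x UNIV] assms
    by (simp add: gen_def)
  moreover have "sq_integrable nu (\<lambda>x. - f x)" "sq_integrable nu (\<lambda>x. - k x)"
    using assms sq_integrable_scale[of nu f "-1"] sq_integrable_scale[of nu k "-1"]
    by (simp_all add: gen_def)
  ultimately show ?thesis
    using assms by (auto simp: gen_def intro!: derivative_eq_intros)
qed

lemma continuous_on_rho: "continuous_on S rho"
  using DERIV_rho by (intro continuous_at_imp_continuous_on ballI DERIV_isCont)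

lemma gen_continuous:
  assumes "gen f f' k"
  shows "continuous_on S f" "continuous_on S f'"
proof -
  show "continuous_on S f"
    using assms by (intro continuous_at_imp_continuous_on ballI DERIV_isCont) (auto simp: gen_def)
  have "continuous_on S (\<lambda>x. rho x * f' x)"
    using assms by (intro continuous_at_imp_continuous_on ballI DERIV_isCont) (auto simp: gen_def)
  then have "continuous_on S (\<lambda>x. (rho x * f' x) / rho x)"
    by (intro continuous_on_divide continuous_on_rho) auto
  then show "continuous_on S f'" by simp
qed

text \<open>A flux \<open>\<rho> f'\<close> bounded below by \<open>c > 0\<close> would force \<open>f\<close> to grow at least like a multiple of
  \<open>\<rho>\<^sup>-\<^sup>1\<^sup>/\<^sup>2\<close>, whose derivative is \<open>(\<beta>/2) U' \<rho>\<^sup>-\<^sup>1\<^sup>/\<^sup>2\<close>.\<close>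

lemma no_positive_flux:
  assumes f: "\<And>x. (f has_real_derivative f' x) (at x)" and L2: "sq_integrable nu f"
    and "0 < c" and flux: "\<And>x. R \<le> x \<Longrightarrow> c \<le> rho x * f' x"
  shows False
proof -
  obtain K where K: "0 < K" "\<And>x. \<bar>dU x\<bar> * sqrt (rho x) \<le> K" using dU_rho_bound by blast
  \<comment> \<open>Normalized so that \<open>eta * (beta / 2) * K = c\<close>: then
    \<open>g = f - eta * rho^(-1/2)\<close> is nondecreasing beyond \<open>R\<close>.\<close>
  define eta where "eta = 2 * c / (beta * K)"
  have eta: "0 < eta" using K \<open>0 < c\<close> beta_pos by (simp add: eta_def)
  define g where "g x = f x - eta * inverse (sqrt (rho x))" for x
  define g' where "g' x = f' x - eta * (beta / 2 * dU x * inverse (sqrt (rho x)))" for x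
  have sq: "sqrt (rho x) * sqrt (rho x) = rho x" for x by simp
  have spos: "0 < sqrt (rho x)" for x using rho_pos[of x] by simp
  have "((\<lambda>x. inverse (sqrt (rho x))) has_real_derivative beta / 2 * dU x * inverse (sqrt (rho x))) (at x)" for x
  proof -
    have "((\<lambda>x. inverse (sqrt (rho x))) has_real_derivative
        - (inverse (sqrt (rho x)) * (inverse (sqrt (rho x)) / 2 * (- beta * dU x * rho x)) * inverse (sqrt (rho x)))) (at x)"
      using spos[of x] rho_pos[of x]
      by (intro DERIV_inverse' DERIV_chain2[where f = sqrt and g = rho] DERIV_real_sqrt DERIV_rho) auto
    also have "- (inverse (sqrt (rho x)) * (inverse (sqrt (rho x)) / 2 * (- beta * dU x * rho x)) * inverse (sqrt (rho x)))
      = beta / 2 * dU x * inverse (sqrt (rho x))"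
      using spos[of x] sq[of x] by (simp add: field_simps)
    finally show ?thesis .
  qed
  then have g: "(g has_real_derivative g' x) (at x)" for x
    unfolding g_def[abs_def] g'_def using f
    by (intro derivative_intros DERIV_cmult)
  have g'_nonneg: "0 \<le> g' x" if "R \<le> x" for x
  proof -
    have "dU x * inverse (sqrt (rho x)) \<le> \<bar>dU x\<bar> * sqrt (rho x) / rho x"
    proof -
      have "inverse (sqrt (rho x)) = sqrt (rho x) / rho x"
        using spos[of x] sq[of x] by (simp add: field_simps)
      then have "dU x * inverse (sqrt (rho x)) = dU x * (sqrt (rho x) / rho x)" by simp
      also have "\<dots> \<le> \<bar>dU x\<bar> * (sqrt (rho x) / rho x)"
        by (intro mult_right_mono) auto
      finally show ?thesis by simp
    qed
    also have "\<dots> \<le> K / rho x"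
      using K(2)[of x] by (intro divide_right_mono) auto
    finally have "eta * (beta / 2) * (dU x * inverse (sqrt (rho x))) \<le> eta * (beta / 2) * (K / rho x)"
      using eta beta_pos by (intro mult_left_mono) auto
    also have "\<dots> = c / rho x"
      using K(1) beta_pos by (simp add: eta_def)
    also have "\<dots> \<le> f' x"
      using flux[OF that] rho_pos[of x] by (simp add: pos_divide_le_eq mult.commute)
    finally show ?thesis by (simp add: g'_def mult.assoc)
  qed
  have mono: "g R \<le> g x" if "R \<le> x" for x
    by (rule DERIV_nonneg_imp_nondecreasing[OF that]) (use g g'_nonneg in blast)
  define d where "d = g R"
  have lower: "eta - \<bar>d\<bar> * sqrt (rho x) \<le> \<bar>f x\<bar> * sqrt (rho x)" if "R \<le> x" for x
  proof -
    have "d + eta * inverse (sqrt (rho x)) \<le> f x"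
      using mono[OF that] by (simp add: g_def d_def)
    then have "(d + eta * inverse (sqrt (rho x))) * sqrt (rho x) \<le> f x * sqrt (rho x)"
      by (intro mult_right_mono) auto
    moreover have "(d + eta * inverse (sqrt (rho x))) * sqrt (rho x) = d * sqrt (rho x) + eta"
      using spos[of x] by (simp add: field_simps)
    moreover have "f x * sqrt (rho x) \<le> \<bar>f x\<bar> * sqrt (rho x)" by (intro mult_right_mono) auto
    moreover have "- \<bar>d\<bar> * sqrt (rho x) \<le> d * sqrt (rho x)" by (intro mult_right_mono) auto
    ultimately show ?thesis by simp
  qed
  define e where "e = eta / 2 / (1 + \<bar>d\<bar>)"
  have e: "0 < e" using eta by (simp add: e_def)
  \<comment> \<open>Adding \<open>rho\<close> to the integrand makes
    \<open>\<bar>f\<bar> * sqrt rho\<close> and \<open>sqrt rho\<close> small at the same point,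
    which the lower bound then contradicts.\<close>
  have "integrable lborel (\<lambda>x. (f x)\<^sup>2 * rho x + rho x)"
    using L2 integrable_rho by (simp add: sq_integrable_nu)
  then obtain x where x: "R \<le> x" "(f x)\<^sup>2 * rho x + rho x \<le> e\<^sup>2"
    using integrable_frequently_small[of "\<lambda>x. (f x)\<^sup>2 * rho x + rho x" "e\<^sup>2" R] e by auto
  have "(f x)\<^sup>2 * rho x \<le> e\<^sup>2" "rho x \<le> e\<^sup>2"
    using x(2) rho_nonneg[of x] mult_nonneg_nonneg[of "(f x)\<^sup>2" "rho x", OF zero_le_power2]
    by linarith+
  then have "\<bar>f x\<bar> * sqrt (rho x) \<le> e" "sqrt (rho x) \<le> e"
    using e real_sqrt_le_mono[of "(f x)\<^sup>2 * rho x" "e\<^sup>2"] real_sqrt_le_mono[of "rho x" "e\<^sup>2"]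
    by (simp_all add: real_sqrt_mult)
  moreover have "\<bar>d\<bar> * sqrt (rho x) \<le> \<bar>d\<bar> * e"
    using calculation by (intro mult_left_mono) auto
  ultimately have "eta \<le> e * (1 + \<bar>d\<bar>)"
    using lower[OF x(1)] by (simp add: algebra_simps)
  also have "\<dots> = eta / 2"
  proof -
    have "1 + \<bar>d\<bar> \<noteq> 0" by linarith
    then show ?thesis by (metis e_def nonzero_divide_eq_eq)
  qed
  finally show False using eta by simp
qed

section \<open>Flux bound and integration by parts\<close>

lemma sq_integrable_Icc:
  assumes "continuous_on UNIV g"
  shows "sq_integrable nu (\<lambda>x. indicator {a..b} x * g x)"
proof -
  have [measurable]: "g \<in> borel_measurable borel"
    using assms by (rule borel_measurable_continuous_onI)
  have "set_integrable lborel {a..b} (\<lambda>x. (g x)\<^sup>2 * rho x)"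
    by (intro borel_integrable_atLeastAtMost' continuous_intros continuous_on_rho
        continuous_on_subset[OF assms]) auto
  moreover have "(\<lambda>x. (indicator {a..b} x * g x)\<^sup>2 * rho x)
      = (\<lambda>x. indicator {a..b} x *\<^sub>R ((g x)\<^sup>2 * rho x))"
    by (auto split: split_indicator)
  moreover have "(\<lambda>x. indicator {a..b} x * g x) \<in> borel_measurable borel" by measurable
  ultimately show ?thesis
    unfolding sq_integrable_nu set_integrable_def by simp
qed

lemma set_integral_rho_Cauchy_Schwarz:
  assumes "sq_integrable nu k"
  shows "(LINT x:{a..b}|lborel. rho x * k x)\<^sup>2 \<le> (LINT x:{a..b}|lborel. rho x) * ip nu k k"
proof -
  have [measurable]: "k \<in> borel_measurable borel" using assms by (simp add: sq_integrable_nu)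
  have "sq_integrable nu (\<lambda>x. indicator {a..b} x)"
    using sq_integrable_Icc[of "\<lambda>x. 1" a b] by simp
  from ip_Cauchy_Schwarz[OF this assms]
  show ?thesis
    by (simp add: ip_nu set_lebesgue_integral_def mult_ac flip: indicator_inter_arith)
qed

text \<open>The flux changes over an interval starting at \<open>x \<ge> 0\<close> by
  \<open>beta\<close> times the integral of \<open>rho * k\<close>. By Cauchy-Schwarz and the tail
  bound this is at most of order \<open>sqrt (rho x)\<close>, so a larger flux at \<open>x\<close>
  would remain above a positive constant, which \<open>no_positive_flux\<close> excludes. Negation
  and reflection give the other sign and the other half-line. The constant does not depend on
  \<open>f\<close>.\<close>

lemma gen_flux_bound_exists:
  obtains C where "0 \<le> C"
    and "\<And>f f' k x. gen f f' k \<Longrightarrow> \<bar>rho x * f' x\<bar> \<le> C * sqrt (ip nu k k) * sqrt (rho x)"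
proof -
  obtain C where C: "0 < C" "\<And>x R. 0 \<le> x \<Longrightarrow> (LINT y:{x..R}|lborel. rho y) \<le> C * rho x"
    using rho_tail_bound by blast
  have upper: "rho x * f' x \<le> beta * sqrt C * sqrt (ip nu k k) * sqrt (rho x)"
    if g: "gen f f' k" and "0 \<le> x" for f f' k x
  proof (rule ccontr)
    define B where "B = beta * sqrt C * sqrt (ip nu k k) * sqrt (rho x)"
    assume "\<not> ?thesis"
    then have pos: "0 < rho x * f' x - B" by (simp add: B_def)
    have k: "sq_integrable nu k" and f: "sq_integrable nu f"
      and df: "\<And>x. (f has_real_derivative f' x) (at x)" using g by (auto simp: gen_def)
    have "rho x * f' x - B \<le> rho y * f' y" if "x \<le> y" for y
    proof -
      have int: "integrable lborel (\<lambda>x. rho x * k x)"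
        using integrable_nu_mult[OF sq_integrable_const[of 1] k] by (simp add: mult.commute)
      have "(LINT z:{x..y}|lborel. beta * (rho z * k z)) = rho y * f' y - rho x * f' x"
        using g int that
        by (intro set_lebesgue_integral_FTC[where F = "\<lambda>x. rho x * f' x"] set_integrable_Icc
              integrable_mult_right)
           (auto simp: gen_def intro: has_field_derivative_at_within)
      moreover have "\<bar>LINT z:{x..y}|lborel. rho z * k z\<bar> \<le> sqrt (C * rho x * ip nu k k)"
      proof (rule real_le_rsqrt[THEN order_trans[rotated]])
        show "(\<bar>LINT z:{x..y}|lborel. rho z * k z\<bar>)\<^sup>2 \<le> C * rho x * ip nu k k"
          using set_integral_rho_Cauchy_Schwarz[OF k, of x y]
            mult_right_mono[OF C(2)[OF \<open>0 \<le> x\<close>, of y] ip_self_nonneg[of nu k]] by simp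
      qed simp
      then have "beta * \<bar>LINT z:{x..y}|lborel. rho z * k z\<bar> \<le> B"
        using beta_pos mult_left_mono[of "\<bar>LINT z:{x..y}|lborel. rho z * k z\<bar>" "sqrt (C * rho x * ip nu k k)" beta]
        by (simp add: B_def real_sqrt_mult mult_ac)
      moreover have "- (beta * \<bar>LINT z:{x..y}|lborel. rho z * k z\<bar>) \<le> beta * (LINT z:{x..y}|lborel. rho z * k z)"
        using beta_pos mult_left_mono[of "- \<bar>LINT z:{x..y}|lborel. rho z * k z\<bar>" "LINT z:{x..y}|lborel. rho z * k z" beta]
        by simp
      ultimately show ?thesis by simp
    qed
    then show False using no_positive_flux[OF df f pos] by blast
  qed
  have pos: "\<bar>rho x * f' x\<bar> \<le> beta * sqrt C * sqrt (ip nu k k) * sqrt (rho x)"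
    if "gen f f' k" "0 \<le> x" for f f' k x
    using upper[OF that] upper[OF gen_minus[OF that(1)] that(2)]
    by (simp add: ip_def abs_le_iff)
  have "\<bar>rho x * f' x\<bar> \<le> beta * sqrt C * sqrt (ip nu k k) * sqrt (rho x)"
    if g: "gen f f' k" for f f' k x
  proof (cases "0 \<le> x")
    case False
    have "k \<in> borel_measurable borel" using g by (simp add: gen_def sq_integrable_nu)
    then show ?thesis
      using pos[OF gen_reflect[OF g], of "- x"] False by (simp add: ip_reflect)
  qed (use pos[OF g] in simp)
  then show ?thesis
    using that[of "beta * sqrt C"] C(1) beta_pos by simp
qed

text \<open>The flux bound dominates the boundary term by a multiple of
  \<open>\<bar>\<phi>\<bar> * sqrt rho\<close>. As \<open>\<phi>\<^sup>2 * rho\<close> is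
  integrable, this is small at arbitrarily large radii, though not necessarily at all of them; hence
  a radius is produced instead of a limit.\<close>

lemma gen_by_parts_approx:
  assumes g: "gen f f' k"
    and \<phi>: "\<And>x. (\<phi> has_real_derivative \<phi>' x) (at x)" "continuous_on UNIV \<phi>'"
    and L2: "sq_integrable nu \<phi>" and "0 < e"
  obtains R where "N \<le> R" "0 \<le> R"
    "\<bar>(LINT x:{-R..R}|lborel. \<phi>' x * f' x * rho x)
       + beta * (LINT x:{-R..R}|lborel. \<phi> x * k x * rho x)\<bar> \<le> e"
proof -
  obtain C where "0 \<le> C"
    and C: "\<And>f f' k x. gen f f' k \<Longrightarrow> \<bar>rho x * f' x\<bar> \<le> C * sqrt (ip nu k k) * sqrt (rho x)"
    using gen_flux_bound_exists by blast
  \<comment> \<open>The summand 1 keeps \<open>B\<close> positive when \<open>k\<close> has norm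
    zero, so that division by \<open>B\<close> is legitimate.\<close>
  define B where "B = C * sqrt (ip nu k k) + 1"
  have "0 < B" using \<open>0 \<le> C\<close> ip_self_nonneg[of nu k] by (simp add: B_def add_nonneg_pos)
  have flux: "\<bar>rho x * f' x\<bar> \<le> B * sqrt (rho x)" for x
    using C[OF g, of x] by (simp add: B_def distrib_right add_increasing2)
  have k: "sq_integrable nu k" using g by (simp add: gen_def)
  have int: "integrable lborel (\<lambda>x. \<phi> x * k x * rho x)"
    using integrable_nu_mult[OF L2 k] .
  \<comment> \<open>Both endpoints are put into one integrable function, so that a single radius
    serves \<open>R\<close> and \<open>- R\<close>.\<close>
  define g where "g x = (\<phi> x)\<^sup>2 * rho x + (\<phi> (- x))\<^sup>2 * rho x" for x
  define c where "c = (e / (2 * B))\<^sup>2"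
  have "0 < c" using \<open>0 < e\<close> \<open>0 < B\<close> by (simp add: c_def)
  have "integrable lborel g"
    using L2 sq_integrable_reflect[OF L2] by (simp add: g_def[abs_def] sq_integrable_nu)
  then obtain R where R: "max N 0 \<le> R" "g R \<le> c"
    using integrable_frequently_small[of g c "max N 0"] \<open>0 < c\<close> by (auto simp: g_def)
  have "(\<phi> R)\<^sup>2 * rho R \<le> c" "(\<phi> (- R))\<^sup>2 * rho R \<le> c"
    using R(2) mult_nonneg_nonneg[of "(\<phi> R)\<^sup>2" "rho R", OF zero_le_power2]
      mult_nonneg_nonneg[of "(\<phi> (- R))\<^sup>2" "rho R", OF zero_le_power2]
    unfolding g_def using rho_nonneg[of R] by linarith+
  then have "\<bar>\<phi> R\<bar> * sqrt (rho R) \<le> e / (2 * B)" "\<bar>\<phi> (- R)\<bar> * sqrt (rho R) \<le> e / (2 * B)"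
    using real_sqrt_le_mono[of "(\<phi> R)\<^sup>2 * rho R" c] real_sqrt_le_mono[of "(\<phi> (- R))\<^sup>2 * rho R" c]
      \<open>0 < e\<close> \<open>0 < B\<close> by (simp_all add: c_def real_sqrt_mult)
  then have small: "\<bar>\<phi> x\<bar> * sqrt (rho x) \<le> e / (2 * B)" if "x \<in> {R, - R}" for x
    using that by auto
  have boundary: "\<bar>\<phi> x * (rho x * f' x)\<bar> \<le> e / 2" if "x \<in> {R, - R}" for x
  proof -
    have "\<bar>\<phi> x * (rho x * f' x)\<bar> \<le> \<bar>\<phi> x\<bar> * (B * sqrt (rho x))"
      using flux[of x] by (simp only: abs_mult[of "\<phi> x"]) (intro mult_left_mono, auto)
    also have "\<dots> = B * (\<bar>\<phi> x\<bar> * sqrt (rho x))" by simp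
    also have "\<dots> \<le> B * (e / (2 * B))"
      using small[OF that] \<open>0 < B\<close> by (intro mult_left_mono) auto
    finally show ?thesis using \<open>0 < B\<close> by simp
  qed
  have i1: "set_integrable lborel {-R..R} (\<lambda>x. \<phi>' x * f' x * rho x)"
    using gen_continuous(2)[OF g] continuous_on_subset[OF \<phi>(2)]
    by (intro borel_integrable_atLeastAtMost' continuous_intros continuous_on_rho) auto
  have i2: "set_integrable lborel {-R..R} (\<lambda>x. beta * (\<phi> x * k x * rho x))"
    using int by (intro set_integrable_Icc integrable_mult_right)
  have "(LINT x:{-R..R}|lborel. \<phi>' x * f' x * rho x + beta * (\<phi> x * k x * rho x))
      = \<phi> R * (rho R * f' R) - \<phi> (- R) * (rho (- R) * f' (- R))"
  proof (rule set_lebesgue_integral_FTC)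
    show "((\<lambda>x. \<phi> x * (rho x * f' x)) has_real_derivative
        \<phi>' x * f' x * rho x + beta * (\<phi> x * k x * rho x)) (at x within {-R..R})" for x
    proof -
      have "((\<lambda>x. rho x * f' x) has_real_derivative beta * (rho x * k x)) (at x)"
        using g by (simp add: gen_def)
      from DERIV_mult[OF \<phi>(1)[of x] this] show ?thesis
        by - (rule has_field_derivative_at_within, simp add: mult_ac)
    qed
    show "set_integrable lborel {-R..R} (\<lambda>x. \<phi>' x * f' x * rho x + beta * (\<phi> x * k x * rho x))"
      using i1 i2 by (rule set_integral_add)
  qed (use R in auto)
  then have "(LINT x:{-R..R}|lborel. \<phi>' x * f' x * rho x)
       + beta * (LINT x:{-R..R}|lborel. \<phi> x * k x * rho x)
      = \<phi> R * (rho R * f' R) - \<phi> (- R) * (rho (- R) * f' (- R))"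
    using set_integral_add(2)[OF i1 i2] by simp
  then show ?thesis
    using boundary[of R] boundary[of "- R"] R by (intro that[of R]) auto
qed

lemma gen_tendsto_ip:
  assumes g: "gen f f' k" and L2: "sq_integrable nu \<phi>"
  shows "((\<lambda>R. LINT x:{-R..R}|lborel. \<phi> x * k x * rho x) \<longlongrightarrow> ip nu \<phi> k) at_top"
proof -
  have k: "sq_integrable nu k" using g by (simp add: gen_def)
  have "ip nu \<phi> k = (\<integral>x. \<phi> x * k x * rho x \<partial>lborel)"
    using k L2 by (intro ip_nu) (auto simp: sq_integrable_nu)
  then show ?thesis
    using tendsto_integral_symmetric[OF integrable_nu_mult[OF L2 k]] by simp
qed

text \<open>The product with \<open>k\<close> is integrable and can be replaced by its full
  integral. The product with \<open>f'\<close> stays truncated, because its integrability is not yet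
  available.\<close>

lemma gen_by_parts_approx':
  assumes g: "gen f f' k"
    and \<phi>: "\<And>x. (\<phi> has_real_derivative \<phi>' x) (at x)" "continuous_on UNIV \<phi>'"
    and L2: "sq_integrable nu \<phi>" and "0 < e"
  obtains R where "N \<le> R" "0 \<le> R"
    "\<bar>(LINT x:{-R..R}|lborel. \<phi>' x * f' x * rho x) + beta * ip nu \<phi> k\<bar> \<le> e"
proof -
  have "((\<lambda>R. beta * (LINT x:{-R..R}|lborel. \<phi> x * k x * rho x)) \<longlongrightarrow> beta * ip nu \<phi> k) at_top"
    by (intro tendsto_mult_left gen_tendsto_ip[OF g L2])
  then have "\<forall>\<^sub>F R in at_top. dist (beta * (LINT x:{-R..R}|lborel. \<phi> x * k x * rho x)) (beta * ip nu \<phi> k) < e / 2"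
    by (rule tendstoD) (use \<open>0 < e\<close> in simp)
  then obtain N' where N': "\<And>R. N' \<le> R \<Longrightarrow>
      dist (beta * (LINT x:{-R..R}|lborel. \<phi> x * k x * rho x)) (beta * ip nu \<phi> k) < e / 2"
    by (auto simp: eventually_at_top_linorder)
  obtain R where R: "max N N' \<le> R" "0 \<le> R"
    "\<bar>(LINT x:{-R..R}|lborel. \<phi>' x * f' x * rho x)
       + beta * (LINT x:{-R..R}|lborel. \<phi> x * k x * rho x)\<bar> \<le> e / 2"
    using gen_by_parts_approx[OF g \<phi> L2, of "e/2" "max N N'"] \<open>0 < e\<close> by auto
  show ?thesis
    using that[of R] R N'[of R] unfolding dist_real_def by linarith
qed

lemma gen_by_parts:
  assumes g: "gen f f' k"
    and \<phi>: "\<And>x. (\<phi> has_real_derivative \<phi>' x) (at x)" "continuous_on UNIV \<phi>'"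
    and L2: "sq_integrable nu \<phi>"
    and int: "integrable lborel (\<lambda>x. \<phi>' x * f' x * rho x)"
  shows "(\<integral>x. \<phi>' x * f' x * rho x \<partial>lborel) = - beta * ip nu \<phi> k"
proof -
  have "\<bar>(\<integral>x. \<phi>' x * f' x * rho x \<partial>lborel) + beta * ip nu \<phi> k\<bar> \<le> 0 + e" if e: "0 < e" for e
  proof -
    have "\<forall>\<^sub>F R in at_top. dist (LINT x:{-R..R}|lborel. \<phi>' x * f' x * rho x)
        (\<integral>x. \<phi>' x * f' x * rho x \<partial>lborel) < e / 2"
      by (rule tendstoD[OF tendsto_integral_symmetric[OF int]]) (use e in simp)
    then obtain N where N: "\<And>R. N \<le> R \<Longrightarrow> dist (LINT x:{-R..R}|lborel. \<phi>' x * f' x * rho x)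
        (\<integral>x. \<phi>' x * f' x * rho x \<partial>lborel) < e / 2"
      by (auto simp: eventually_at_top_linorder)
    obtain R where "N \<le> R"
      "\<bar>(LINT x:{-R..R}|lborel. \<phi>' x * f' x * rho x) + beta * ip nu \<phi> k\<bar> \<le> e / 2"
      using gen_by_parts_approx'[OF g \<phi> L2, of "e/2" N] e by auto
    with N[of R] show ?thesis unfolding dist_real_def by linarith
  qed
  then have "\<bar>(\<integral>x. \<phi>' x * f' x * rho x \<partial>lborel) + beta * ip nu \<phi> k\<bar> \<le> 0"
    by (rule field_le_epsilon)
  then show ?thesis by simp
qed

text \<open>Testing with a constant: this is conservation of mass.\<close>

lemma gen_mean:
  assumes "gen f f' k"
  shows "ip nu (\<lambda>x. 1) k = 0"
  using gen_by_parts[OF assms, of "\<lambda>x. 1" "\<lambda>x. 0"] sq_integrable_const[of 1] beta_pos by simp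

text \<open>Testing with \<open>f\<close> itself. The truncated integral of a nonnegative function
  grows with the radius, so a good radius beyond \<open>R\<close> suffices; no prior bound on
  \<open>f'\<close> in \<open>L2(rho)\<close> enters.\<close>

lemma gen_dissipation:
  assumes g: "gen f f' k" and "0 \<le> R"
  shows "(LINT x:{-R..R}|lborel. (f' x)\<^sup>2 * rho x) \<le> - beta * ip nu f k"
proof (rule field_le_epsilon)
  fix e :: real assume "0 < e"
  have f: "\<And>x. (f has_real_derivative f' x) (at x)" "sq_integrable nu f"
    using g by (auto simp: gen_def)
  obtain R' where R': "R \<le> R'"
    "\<bar>(LINT x:{-R'..R'}|lborel. f' x * f' x * rho x) + beta * ip nu f k\<bar> \<le> e"
    using gen_by_parts_approx'[OF g f(1) gen_continuous(2)[OF g] f(2) \<open>0 < e\<close>, of R] by auto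
  have int: "set_integrable lborel {a..b} (\<lambda>x. (f' x)\<^sup>2 * rho x)" for a b
    by (intro borel_integrable_atLeastAtMost' continuous_intros continuous_on_rho
        gen_continuous(2)[OF g])
  have "(LINT x:{-R..R}|lborel. (f' x)\<^sup>2 * rho x) \<le> (LINT x:{-R'..R'}|lborel. (f' x)\<^sup>2 * rho x)"
    unfolding set_lebesgue_integral_def
    using R'(1) int[unfolded set_integrable_def]
    by (intro integral_mono) (auto split: split_indicator)
  with R'(2) show "(LINT x:{-R..R}|lborel. (f' x)\<^sup>2 * rho x) \<le> - beta * ip nu f k + e"
    by (simp add: power2_eq_square)
qed

lemma gen_dissipation_nonneg:
  assumes "gen f f' k"
  shows "0 \<le> - beta * ip nu f k"
proof -
  have "0 \<le> (LINT x:{-0..0}|lborel. (f' x)\<^sup>2 * rho x)"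
    unfolding set_lebesgue_integral_def by (rule integral_nonneg_AE) simp
  then show ?thesis using gen_dissipation[OF assms, of 0] by linarith
qed

text \<open>Testing with \<open>x\<close> turns \<open>beta * ip nu (\<lambda>x. x) k\<close> into
  minus the mean of \<open>f'\<close>, which Cauchy-Schwarz bounds by the dissipation. It will
  control the cross term created by the \<epsilon>-shift of the energy.\<close>

lemma gen_first_moment:
  assumes g: "gen f f' k"
  shows "(beta * ip nu (\<lambda>x. x) k)\<^sup>2 \<le> - beta * ip nu f k"
proof -
  define D where "D = - beta * ip nu f k"
  have D: "0 \<le> D" using gen_dissipation_nonneg[OF g] by (simp add: D_def)
  have "\<bar>beta * ip nu (\<lambda>x. x) k\<bar> \<le> sqrt D + e" if e: "0 < e" for e
  proof -
    obtain R where R: "0 \<le> R"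
      "\<bar>(LINT x:{-R..R}|lborel. 1 * f' x * rho x) + beta * ip nu (\<lambda>x. x) k\<bar> \<le> e"
      using gen_by_parts_approx'[OF g DERIV_ident _ sq_integrable_id e, of 0] by auto
    \<comment> \<open>Truncation makes \<open>f'\<close> square integrable by continuity
      alone.\<close>
    define q where "q x = indicator {-R..R} x * f' x" for x
    have q: "sq_integrable nu q"
      unfolding q_def[abs_def] by (rule sq_integrable_Icc[OF gen_continuous(2)[OF g]])
    have "ip nu q q = (LINT x:{-R..R}|lborel. (f' x)\<^sup>2 * rho x)"
      unfolding set_lebesgue_integral_def
      using q by (subst ip_nu) (auto simp: sq_integrable_nu q_def power2_eq_square
          intro!: Bochner_Integration.integral_cong split: split_indicator)
    moreover have "ip nu (\<lambda>x. 1) q = (LINT x:{-R..R}|lborel. 1 * f' x * rho x)"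
      unfolding set_lebesgue_integral_def
      using q by (subst ip_nu) (auto simp: sq_integrable_nu q_def mult_ac)
    ultimately have "(LINT x:{-R..R}|lborel. 1 * f' x * rho x)\<^sup>2 \<le> D"
      using ip_Cauchy_Schwarz[OF sq_integrable_const[of 1] q] gen_dissipation[OF g R(1)]
      by (simp add: ip_one_one D_def)
    then have "\<bar>LINT x:{-R..R}|lborel. 1 * f' x * rho x\<bar> \<le> sqrt D"
      using real_sqrt_le_mono by fastforce
    with R(2) show ?thesis by linarith
  qed
  then have "\<bar>beta * ip nu (\<lambda>x. x) k\<bar> \<le> sqrt D" by (rule field_le_epsilon)
  then have "\<bar>beta * ip nu (\<lambda>x. x) k\<bar>\<^sup>2 \<le> (sqrt D)\<^sup>2" by (intro power_mono) auto
  then show ?thesis using D by (simp add: D_def)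
qed

section \<open>Poincare inequality\<close>

text \<open>Hardy inequality: integrate \<open>((f - f 0)\<^sup>2 T)'\<close> with \<open>T x = \<integral>\<^sub>x\<^sup>R \<rho>\<close>, which satisfies
  \<open>T' = - \<rho>\<close>, \<open>T R = 0\<close> and \<open>T \<le> C \<rho>\<close>.\<close>

lemma Hardy_half_line:
  obtains P where "0 < P" and "\<And>f f' R. (\<And>x. (f has_real_derivative f' x) (at x)) \<Longrightarrow>
    continuous_on UNIV f' \<Longrightarrow> 0 \<le> R \<Longrightarrow>
    (LINT x:{0..R}|lborel. (f x - f 0)\<^sup>2 * rho x) \<le> P * (LINT x:{0..R}|lborel. (f' x)\<^sup>2 * rho x)"
proof -
  obtain C where C: "0 < C" "\<And>x R. 0 \<le> x \<Longrightarrow> (LINT y:{x..R}|lborel. rho y) \<le> C * rho x"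
    using rho_tail_bound by blast
  have main: "(LINT x:{0..R}|lborel. (f x - f 0)\<^sup>2 * rho x)
      \<le> 4 * C\<^sup>2 * (LINT x:{0..R}|lborel. (f' x)\<^sup>2 * rho x)"
    if f: "\<And>x. (f has_real_derivative f' x) (at x)" and f': "continuous_on UNIV f'" and "0 \<le> R"
    for f f' :: "real \<Rightarrow> real" and R
  proof -
    obtain \<Phi> where \<Phi>: "\<And>x. x \<in> {0..R} \<Longrightarrow> (\<Phi> has_real_derivative rho x) (at x within {0..R})"
      using antiderivative_continuous[OF continuous_on_rho, of 0 R]
      by (auto simp: has_real_derivative_iff_has_vector_derivative)
    define T where "T x = \<Phi> R - \<Phi> x" for x
    have T: "0 \<le> T x" "T x \<le> C * rho x" if "x \<in> {0..R}" for x
    proof -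
      have "(LINT y:{x..R}|lborel. rho y) = T x"
        unfolding T_def using that
        by (intro set_lebesgue_integral_FTC set_integrable_Icc integrable_rho)
           (auto intro!: DERIV_subset[OF \<Phi>])
      moreover have "0 \<le> (LINT y:{x..R}|lborel. rho y)"
        by (auto simp: set_lebesgue_integral_def intro!: integral_nonneg_AE)
      ultimately show "0 \<le> T x" "T x \<le> C * rho x" using C(2)[of x R] that by auto
    qed
    have DT: "(T has_real_derivative - rho x) (at x within {0..R})" if "x \<in> {0..R}" for x
      unfolding T_def[abs_def] using DERIV_diff[OF DERIV_const \<Phi>[OF that]] by simp
    have cT: "continuous_on {0..R} T"
      using DT by (rule DERIV_continuous_on)
    have cf: "continuous_on {0..R} f"
      using f by (intro continuous_at_imp_continuous_on ballI DERIV_isCont)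
    have cf': "continuous_on {0..R} f'" using f' continuous_on_subset by blast
    have int: "set_integrable lborel {0..R} (\<lambda>x. (f x - f 0)\<^sup>2 * rho x)"
         "set_integrable lborel {0..R} (\<lambda>x. (f' x)\<^sup>2 * rho x)"
         "set_integrable lborel {0..R} (\<lambda>x. 2 * (f x - f 0) * f' x * T x - (f x - f 0)\<^sup>2 * rho x)"
      by (intro borel_integrable_atLeastAtMost' continuous_intros continuous_on_rho cf cf' cT)+
    have "(LINT x:{0..R}|lborel. 2 * (f x - f 0) * f' x * T x - (f x - f 0)\<^sup>2 * rho x)
        = (f R - f 0)\<^sup>2 * T R - (f 0 - f 0)\<^sup>2 * T 0"
    proof (rule set_lebesgue_integral_FTC)
      fix x assume "0 \<le> x" "x \<le> R"
      then have x: "x \<in> {0..R}" by simp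
      have "((\<lambda>x. (f x - f 0)\<^sup>2) has_real_derivative 2 * (f x - f 0) * f' x) (at x within {0..R})"
        using DERIV_power[OF DERIV_diff[OF f[of x] DERIV_const[of "f 0"]], where n = 2]
        by - (rule has_field_derivative_at_within, simp add: mult_ac)
      from DERIV_mult[OF this DT[OF x]]
      show "((\<lambda>x. (f x - f 0)\<^sup>2 * T x) has_real_derivative
          2 * (f x - f 0) * f' x * T x - (f x - f 0)\<^sup>2 * rho x) (at x within {0..R})"
        by (simp add: mult_ac)
    qed (use \<open>0 \<le> R\<close> int in auto)
    then have "0 = (LINT x:{0..R}|lborel. 2 * (f x - f 0) * f' x * T x - (f x - f 0)\<^sup>2 * rho x)"
      by (simp add: T_def)
    also have "\<dots> \<le> (LINT x:{0..R}|lborel. 2 * C\<^sup>2 * ((f' x)\<^sup>2 * rho x) - 1 / 2 * ((f x - f 0)\<^sup>2 * rho x))"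
    proof (rule set_integral_mono)
      show "set_integrable lborel {0..R}
          (\<lambda>x. 2 * C\<^sup>2 * ((f' x)\<^sup>2 * rho x) - 1 / 2 * ((f x - f 0)\<^sup>2 * rho x))"
        using int by (intro set_integral_diff set_integrable_mult_right)
      fix x assume x: "x \<in> {0..R}"
      have "2 * (f x - f 0) * f' x * T x \<le> 2 * \<bar>f x - f 0\<bar> * \<bar>f' x\<bar> * T x"
      proof (rule mult_right_mono)
        show "2 * (f x - f 0) * f' x \<le> 2 * \<bar>f x - f 0\<bar> * \<bar>f' x\<bar>"
          using abs_ge_self[of "(f x - f 0) * f' x"] unfolding abs_mult by linarith
      qed (rule T(1)[OF x])
      also have "\<dots> \<le> 2 * \<bar>f x - f 0\<bar> * \<bar>f' x\<bar> * (C * rho x)"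
        using T[OF x] by (intro mult_left_mono) auto
      \<comment> \<open>Young's inequality with weights that leave half of the left-hand integral to
        be absorbed; this produces the constant \<open>4 * C\<^sup>2\<close>.\<close>
      also have "\<dots> \<le> (2 * C\<^sup>2 * (f' x)\<^sup>2 + 1 / 2 * (f x - f 0)\<^sup>2) * rho x"
      proof -
        have "0 \<le> (2 * C * \<bar>f' x\<bar> - \<bar>f x - f 0\<bar>)\<^sup>2 / 2" by simp
        also have "\<dots> = 2 * C\<^sup>2 * (f' x)\<^sup>2 + 1 / 2 * (f x - f 0)\<^sup>2 - 2 * \<bar>f x - f 0\<bar> * \<bar>f' x\<bar> * C"
          by (simp add: power2_diff power_mult_distrib)
        finally have "2 * \<bar>f x - f 0\<bar> * \<bar>f' x\<bar> * C * rho x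
            \<le> (2 * C\<^sup>2 * (f' x)\<^sup>2 + 1 / 2 * (f x - f 0)\<^sup>2) * rho x"
          by (intro mult_right_mono) auto
        then show ?thesis by (simp add: mult_ac)
      qed
      finally show "2 * (f x - f 0) * f' x * T x - (f x - f 0)\<^sup>2 * rho x
          \<le> 2 * C\<^sup>2 * ((f' x)\<^sup>2 * rho x) - 1 / 2 * ((f x - f 0)\<^sup>2 * rho x)"
        by (simp add: distrib_right)
    qed (rule int)
    also have "\<dots> = (LINT x:{0..R}|lborel. 2 * C\<^sup>2 * ((f' x)\<^sup>2 * rho x))
        - (LINT x:{0..R}|lborel. 1 / 2 * ((f x - f 0)\<^sup>2 * rho x))"
      using int by (intro set_integral_diff set_integrable_mult_right)
    finally show ?thesis by simp
  qed
  show ?thesis using that[of "4 * C\<^sup>2"] C(1) main by simp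
qed

text \<open>The Hardy inequality on the two half-lines bounds the square of \<open>f - f 0\<close>.
  For mean zero this square equals that of \<open>f\<close> plus \<open>(f 0)\<^sup>2\<close>, so
  replacing the value at 0 by the mean only helps.\<close>

lemma gen_Poincare:
  obtains P where "0 < P" and "\<And>f f' k. gen f f' k \<Longrightarrow> ip nu f (\<lambda>x. 1) = 0 \<Longrightarrow>
    ip nu f f \<le> P * (- beta * ip nu f k)"
proof -
  obtain P where P: "0 < P" and hardy: "\<And>f f' R. (\<And>x. (f has_real_derivative f' x) (at x)) \<Longrightarrow>
    continuous_on UNIV f' \<Longrightarrow> 0 \<le> R \<Longrightarrow>
    (LINT x:{0..R}|lborel. (f x - f 0)\<^sup>2 * rho x) \<le> P * (LINT x:{0..R}|lborel. (f' x)\<^sup>2 * rho x)"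
    using Hardy_half_line by blast
  have main: "ip nu f f \<le> P * (- beta * ip nu f k)"
    if g: "gen f f' k" and mean: "ip nu f (\<lambda>x. 1) = 0" for f f' k
  proof -
    note g' = gen_reflect[OF g]
    have f: "\<And>x. (f has_real_derivative f' x) (at x)" "sq_integrable nu f"
      and f2: "\<And>x. ((\<lambda>x. f (- x)) has_real_derivative - f' (- x)) (at x)"
      using g g' by (auto simp: gen_def)
    have c: "continuous_on UNIV (\<lambda>x. (f x - f 0)\<^sup>2 * rho x)"
        "continuous_on UNIV (\<lambda>x. (f' x)\<^sup>2 * rho x)"
      by (intro continuous_intros continuous_on_rho gen_continuous[OF g])+
    have le: "(LINT x:{-R..R}|lborel. (f x - f 0)\<^sup>2 * rho x) \<le> P * (- beta * ip nu f k)"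
      if "0 \<le> R" for R
    proof -
      have "(LINT x:{-R..R}|lborel. (f x - f 0)\<^sup>2 * rho x)
          = (LINT x:{0..R}|lborel. (f x - f 0)\<^sup>2 * rho x)
            + (LINT x:{0..R}|lborel. (f (- x) - f 0)\<^sup>2 * rho x)"
        using that c(1) by (subst set_lebesgue_integral_symmetric) simp_all
      also have "\<dots> \<le> P * (LINT x:{0..R}|lborel. (f' x)\<^sup>2 * rho x)
            + P * (LINT x:{0..R}|lborel. (f' (- x))\<^sup>2 * rho x)"
        using hardy[OF f(1) gen_continuous(2)[OF g] that]
          hardy[OF f2 gen_continuous(2)[OF g'] that] by simp
      also have "\<dots> = P * (LINT x:{-R..R}|lborel. (f' x)\<^sup>2 * rho x)"
        using that c(2) by (subst set_lebesgue_integral_symmetric) (simp_all add: distrib_left)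
      also have "\<dots> \<le> P * (- beta * ip nu f k)"
        using P gen_dissipation[OF g that] by (intro mult_left_mono) auto
      finally show ?thesis .
    qed
    have d: "sq_integrable nu (\<lambda>x. f x - f 0)"
      using f(2) by (intro sq_integrable_diff sq_integrable_const)
    have "ip nu (\<lambda>x. f x - f 0) (\<lambda>x. f x - f 0) = (\<integral>x. (f x - f 0)\<^sup>2 * rho x \<partial>lborel)"
      using d by (subst ip_nu) (auto simp: sq_integrable_nu power2_eq_square)
    moreover have "integrable lborel (\<lambda>x. (f x - f 0)\<^sup>2 * rho x)"
      using d by (simp add: sq_integrable_nu)
    note tendsto_integral_symmetric[OF this]
    then have "(\<integral>x. (f x - f 0)\<^sup>2 * rho x \<partial>lborel) \<le> P * (- beta * ip nu f k)"
    proof (rule tendsto_upperbound)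
      show "\<forall>\<^sub>F R in at_top. (LINT x:{-R..R}|lborel. (f x - f 0)\<^sup>2 * rho x) \<le> P * (- beta * ip nu f k)"
        using eventually_ge_at_top[of 0] by eventually_elim (rule le)
    qed simp
    moreover have "ip nu (\<lambda>x. f x - f 0) (\<lambda>x. f x - f 0) = ip nu f f + (f 0)\<^sup>2"
      using ip_self_add_scale[OF f(2) sq_integrable_const[of 1], of "- f 0"] mean
      by (simp add: ip_one_one)
    moreover have "0 \<le> (f 0)\<^sup>2" by simp
    ultimately show ?thesis by linarith
  qed
  show ?thesis using that P main by blast
qed

text \<open>With zero right-hand side the flux bound makes \<open>f'\<close> vanish. Membership of
  \<open>f\<close> in \<open>L2(rho)\<close> is what rules out the other homogeneous solutions, with
  \<open>f'\<close> a nonzero multiple of \<open>1 / rho\<close>.\<close>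

lemma gen_zero_imp_const:
  assumes "gen f f' (\<lambda>x. 0)"
  obtains c where "\<And>x. f x = c"
proof -
  obtain C where "0 \<le> C"
    and "\<And>f f' k x. gen f f' k \<Longrightarrow> \<bar>rho x * f' x\<bar> \<le> C * sqrt (ip nu k k) * sqrt (rho x)"
    using gen_flux_bound_exists by blast
  from this(2)[OF assms] have "f' x = 0" for x by (simp add: ip_def)
  then have "\<And>x. (f has_real_derivative 0) (at x)" using assms by (simp add: gen_def)
  then have "f x = f 0" for x using DERIV_isconst_all by blast
  then show ?thesis using that by blast
qed

section \<open>The second moment above the critical value\<close>

lemma gen_id: "gen (\<lambda>x. x) (\<lambda>x. 1) (\<lambda>x. - dU x)"
  using DERIV_rho sq_integrable_id sq_integrable_scale[OF sq_integrable_dU, of "-1"]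
  by (auto simp: gen_def mult_ac)

lemma v_nonneg: "0 \<le> v"
  by (simp add: v_def ip_self_nonneg)

text \<open>Applying the generator to \<open>x\<close> and testing with \<open>x\<close> gives
  \<open>beta * E[x U'(x)] = 1\<close>; the fourth moment in it is at least \<open>v\<^sup>2\<close>
  by Cauchy-Schwarz.\<close>

lemma second_moment_bound: "beta * (v\<^sup>2 + (A - 1) * v) \<le> 1"
proof -
  have "1 = - beta * ip nu (\<lambda>x. x) (\<lambda>x. - dU x)"
    using gen_by_parts[OF gen_id, of "\<lambda>x. x" "\<lambda>x. 1"] integrable_rho sq_integrable_id
    by (simp add: integral_rho)
  also have "\<dots> = beta * ip nu (\<lambda>x. x) dU"
    using ip_scale_right[of nu "\<lambda>x. x" "-1" dU] by simp
  also have "ip nu (\<lambda>x. x) dU = ip nu (\<lambda>x. x) (\<lambda>x. x ^ 3) + (A - 1) * v"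
    unfolding dU_def[abs_def] v_def
    by (subst ip_add_right)
       (simp_all add: ip_scale_right sq_integrable_id sq_integrable_power sq_integrable_scale)
  also have "ip nu (\<lambda>x. x) (\<lambda>x. x ^ 3) = ip nu (\<lambda>x. x ^ 2) (\<lambda>x. x ^ 2)"
    unfolding ip_def by (simp add: eval_nat_numeral mult_ac)
  finally have 1: "1 = beta * (ip nu (\<lambda>x. x ^ 2) (\<lambda>x. x ^ 2) + (A - 1) * v)" .
  have "v = ip nu (\<lambda>x. x ^ 2) (\<lambda>x. 1)"
    by (simp add: v_def ip_def power2_eq_square)
  then have "v\<^sup>2 \<le> ip nu (\<lambda>x. x ^ 2) (\<lambda>x. x ^ 2)"
    using ip_Cauchy_Schwarz[OF sq_integrable_power[of 2] sq_integrable_const[of 1]]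
    by (simp add: ip_one_one)
  then have "beta * (v\<^sup>2 + (A - 1) * v) \<le> beta * (ip nu (\<lambda>x. x ^ 2) (\<lambda>x. x ^ 2) + (A - 1) * v)"
    using beta_pos by (intro mult_left_mono) auto
  with 1 show ?thesis by linarith
qed

text \<open>If the claim failed, \<open>A * beta < 1\<close> would force \<open>v > 1\<close>,
  whereas inserting \<open>A * beta * v \<ge> 1\<close> into the second moment bound leaves
  \<open>beta * v * (v - 1) \<le> 0\<close>.\<close>

lemma second_moment_large_temperature:
  assumes "2 * A < s\<^sup>2"
  shows "A * beta * v < 1"
proof (rule ccontr)
  assume "\<not> ?thesis"
  then have ge: "1 \<le> A * beta * v" by simp
  have "A * beta < 1" using assms s_pos by (simp add: beta_def)
  have "1 < v"
  proof (rule ccontr)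
    assume "\<not> 1 < v"
    then have "A * beta * v \<le> A * beta * 1"
      using A_pos beta_pos by (intro mult_left_mono) auto
    then show False using ge \<open>A * beta < 1\<close> by simp
  qed
  have "beta * (v * (v - 1)) \<le> 0"
    using second_moment_bound ge by (simp add: algebra_simps power2_eq_square)
  then show False
    using \<open>1 < v\<close> mult_pos_pos[OF beta_pos mult_pos_pos[of v "v - 1"]] by simp
qed

end

section \<open>Dependence of the moments on sigma\<close>

lemma continuous_on_gibbs_weight_moment:
  assumes "0 \<le> A" "0 < a"
  shows "continuous_on {a..b} (\<lambda>s. \<integral>x. x ^ n * gibbs_weight A s x \<partial>lborel)"
proof (rule continuous_on_sequentiallyI)
  fix u r assume u: "\<forall>n. u n \<in> {a..b}" and r: "r \<in> {a..b}" and lim: "u \<longlonglongrightarrow> r"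
  then have "0 < r" "0 < b" using assms by auto
  show "(\<lambda>k. \<integral>x. x ^ n * gibbs_weight A (u k) x \<partial>lborel) \<longlonglongrightarrow> (\<integral>x. x ^ n * gibbs_weight A r x \<partial>lborel)"
  proof (rule integral_dominated_convergence)
    show "integrable lborel (\<lambda>x. \<bar>x ^ n * gibbs_weight A a x\<bar> + \<bar>x ^ n * gibbs_weight A b x\<bar>)"
      using assms \<open>0 < b\<close>
      by (intro Bochner_Integration.integrable_add integrable_abs integrable_gibbs_weight_moment)
    show "AE x in lborel. (\<lambda>k. x ^ n * gibbs_weight A (u k) x) \<longlonglongrightarrow> x ^ n * gibbs_weight A r x"
      unfolding gibbs_weight_def using \<open>0 < r\<close> by (intro AE_I2 tendsto_intros lim) auto
    fix k
    have "norm (x ^ n * gibbs_weight A (u k) x)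
        \<le> \<bar>x ^ n * gibbs_weight A a x\<bar> + \<bar>x ^ n * gibbs_weight A b x\<bar>" for x
    proof -
      have uk: "a \<le> u k" "u k \<le> b" "0 < u k" using u assms(2) by (auto intro: less_le_trans)
      \<comment> \<open>For fixed \<open>x\<close> the weight is monotone in sigma, in a direction
        given by the sign of the potential. That sign varies with \<open>x\<close> when
        \<open>A < 1\<close>, so the dominating function adds both endpoint weights.\<close>
      have "gibbs_weight A (u k) x \<le> gibbs_weight A a x + gibbs_weight A b x"
      proof (cases "0 \<le> Vbar0 A x")
        case True
        have "2 / b\<^sup>2 * Vbar0 A x \<le> 2 / (u k)\<^sup>2 * Vbar0 A x"
          using uk True by (intro mult_right_mono divide_left_mono power_mono) auto
        then have "gibbs_weight A (u k) x \<le> gibbs_weight A b x"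
          by (simp add: gibbs_weight_def)
        then show ?thesis using gibbs_weight_pos[of A a x] by linarith
      next
        case False
        have "2 / a\<^sup>2 * Vbar0 A x \<le> 2 / (u k)\<^sup>2 * Vbar0 A x"
          using uk False assms(2) by (intro mult_right_mono_neg divide_left_mono power_mono) auto
        then have "gibbs_weight A (u k) x \<le> gibbs_weight A a x"
          by (simp add: gibbs_weight_def)
        then show ?thesis using gibbs_weight_pos[of A b x] by linarith
      qed
      then have "\<bar>x ^ n\<bar> * gibbs_weight A (u k) x \<le> \<bar>x ^ n\<bar> * (gibbs_weight A a x + gibbs_weight A b x)"
        by (intro mult_left_mono) auto
      then show ?thesis
        using gibbs_weight_pos[of A "u k" x] gibbs_weight_pos[of A a x] gibbs_weight_pos[of A b x]
        by (simp add: abs_mult distrib_left)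
    qed
    then show "AE x in lborel. norm (x ^ n * gibbs_weight A (u k) x)
        \<le> \<bar>x ^ n * gibbs_weight A a x\<bar> + \<bar>x ^ n * gibbs_weight A b x\<bar>"
      by simp
  qed auto
qed

context quartic_gibbs begin

lemma subcritical:
  assumes "0 < sc" and unique: "\<And>r. 0 < r \<Longrightarrow> critical_equation A r \<Longrightarrow> r = sc" and "sc < s"
  shows "A * beta * v < 1"
proof (rule ccontr)
  assume "\<not> ?thesis"
  define I where "I n r = (\<integral>x. x ^ n * gibbs_weight A r x \<partial>lborel)" for n :: nat and r
  \<comment> \<open>The critical equation with its denominators cleared: \<open>D\<close> is
    continuous, has the sign of \<open>A * beta * v - 1\<close>, and its positive zeros are the
    critical values.\<close>
  define D where "D r = 2 * A * I 2 r - r\<^sup>2 * I 0 r" for r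
  have D: "quartic_gibbs A r \<and> 0 < I 0 r \<and>
      D r = r\<^sup>2 * I 0 r * (A * quartic_gibbs.beta r * quartic_gibbs.v A r - 1)" if "0 < r" for r
  proof -
    interpret r: quartic_gibbs A r using A_pos that by unfold_locales
    have Z: "r.Z = I 0 r" by (simp add: r.Z_def I_def)
    have "r.v = I 2 r / I 0 r"
      by (simp add: r.v_def r.ip_nu Z[symmetric])
         (simp add: r.rho_eq I_def power2_eq_square)
    moreover have "0 < I 0 r" using r.Z_pos by (simp add: Z)
    ultimately show ?thesis
      using that r.quartic_gibbs_axioms by (simp add: D_def r.beta_def field_simps)
  qed
  \<comment> \<open>Large enough that \<open>S \<ge> s\<close> and, through
    \<open>S \<ge> 2 * A + 1\<close>, also \<open>S\<^sup>2 > 2 * A\<close>.\<close>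
  define S where "S = s + 2 * A + 1"
  have S: "0 < S" "s \<le> S" using A_pos s_pos by (simp_all add: S_def)
  have "(2 * A + 1)\<^sup>2 \<le> S\<^sup>2" using A_pos s_pos by (intro power_mono) (simp_all add: S_def)
  moreover have "2 * A < (2 * A + 1)\<^sup>2" using A_pos by (simp add: power2_eq_square algebra_simps add_pos_nonneg)
  ultimately have "2 * A < S\<^sup>2" by linarith
  then have "D S \<le> 0"
    using D[OF S(1)] quartic_gibbs.second_moment_large_temperature[of A S] S(1)
    by (simp add: mult_nonneg_nonpos)
  moreover have "0 \<le> D s"
    using D[OF s_pos] \<open>\<not> A * beta * v < 1\<close> by simp
  moreover have "continuous_on {s..S} D"
    unfolding D_def I_def using A_pos s_pos
    by (intro continuous_intros continuous_on_gibbs_weight_moment) auto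
  ultimately obtain r where r: "s \<le> r" "D r = 0"
    using IVT2'[of D S 0 s] S(2) by auto
  then have "0 < r" using s_pos by simp
  then have "A * quartic_gibbs.beta r * quartic_gibbs.v A r = 1"
    using D[of r] r(2) by auto
  then have "critical_equation A r"
    using D[OF \<open>0 < r\<close>] quartic_gibbs.critical_equation_iff by blast
  from unique[OF \<open>0 < r\<close> this] show False using r(1) assms(3) by simp
qed

end

text \<open>Solutions are differentiable only at positive times and merely continuous at zero, so
  the comparison is with a limit from the right.\<close>

lemma nonincreasing_limit_bound:
  fixes g :: "real \<Rightarrow> real"
  assumes D: "\<And>t. 0 < t \<Longrightarrow> (g has_real_derivative g' t) (at t)"
    and neg: "\<And>t. 0 < t \<Longrightarrow> g' t \<le> 0"
    and lim: "(g \<longlongrightarrow> l) (at_right 0)" and "0 < t"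
  shows "g t \<le> l"
proof (rule tendsto_lowerbound[OF lim])
  have "g t \<le> g u" if "0 < u" "u < t" for u
  proof (rule DERIV_nonpos_imp_nonincreasing[where f = g])
    show "\<exists>y. (g has_real_derivative y) (at x) \<and> y \<le> 0" if "u \<le> x" for x
      using D[of x] neg[of x] \<open>0 < u\<close> that by auto
  qed (use that in simp)
  then show "\<forall>\<^sub>F u in at_right 0. g t \<le> g u"
    using \<open>0 < t\<close> by (auto simp: eventually_at_right[OF \<open>0 < t\<close>])
qed simp

lemma tendsto_zero_sum_component:
  fixes f :: "'b \<Rightarrow> 'i \<Rightarrow> real"
  assumes "((\<lambda>r. \<Sum>i\<in>I. f r i) \<longlongrightarrow> 0) F" "\<And>r i. 0 \<le> f r i" "finite I" "i \<in> I"
  shows "((\<lambda>r. f r i) \<longlongrightarrow> 0) F"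
proof (rule tendsto_sandwich[OF _ _ tendsto_const assms(1)])
  show "\<forall>\<^sub>F r in F. f r i \<le> (\<Sum>i\<in>I. f r i)"
    using assms(2-4) by (intro always_eventually allI member_le_sum) auto
qed (use assms(2) in auto)

context quartic_gibbs begin

section \<open>Exponential decay\<close>

text \<open>For \<open>e = 0\<close> the left-hand side is exactly
  \<open>2 * sum w_i <f^i, k^i>\<close>, which does not see species of weight zero. The shift adds
  their dissipation and a cross term with \<open>m\<close>. Half of the added dissipation absorbs
  one part of the cross term; the remaining \<open>m\<^sup>2\<close> is absorbed by the weighted
  dissipation, because below criticality \<open>m\<close> can be recovered from the
  \<open>f^i\<close>.\<close>

lemma energy_dissipation:
  fixes w :: "'m::finite \<Rightarrow> real"
  assumes w: "\<And>i. 0 \<le> w i" "(\<Sum>i\<in>UNIV. w i) = A" and sub: "A * beta * v < 1"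
  obtains e r where "0 < e" "0 < r" and
    "\<And>h f' k m. m = (\<Sum>j\<in>UNIV. w j * ip nu (h j) (\<lambda>x. x)) \<Longrightarrow>
       (\<And>i. sq_integrable nu (h i)) \<Longrightarrow>
       (\<And>i. ip nu (h i) (\<lambda>x. 1) = 0) \<Longrightarrow>
       (\<And>i. gen (\<lambda>x. h i x - beta * m * x) (f' i) (k i)) \<Longrightarrow>
       (\<Sum>i\<in>UNIV. (w i + e) * (2 * ip nu (h i) (k i)))
         - beta * (2 * m * (\<Sum>j\<in>UNIV. w j * ip nu (k j) (\<lambda>x. x)))
       \<le> - r * ((\<Sum>i\<in>UNIV. (w i + e) * ip nu (h i) (h i)) - beta * m\<^sup>2)"
proof -
  obtain P where P: "0 < P" and Poincare: "\<And>f f' k. gen f f' k \<Longrightarrow> ip nu f (\<lambda>x. 1) = 0 \<Longrightarrow>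
    ip nu f f \<le> P * (- beta * ip nu f k)"
    using gen_Poincare by blast
  define \<kappa> where "\<kappa> = 1 - A * beta * v"
  have \<kappa>: "0 < \<kappa>" using sub by (simp add: \<kappa>_def)
  \<comment> \<open>From \<open>\<kappa> * m = sum w_j <f^j, x>\<close> and Cauchy-Schwarz:
    \<open>m\<^sup>2\<close> is at most \<open>Q\<close> times the weighted square of the
    \<open>f^j\<close>.\<close>
  define Q where "Q = A * v / \<kappa>\<^sup>2"
  have Q: "0 \<le> Q" using A_pos v_nonneg by (simp add: Q_def)
  define N where "N = real CARD('m)"
  have N: "0 < N" by (simp add: N_def)
  \<comment> \<open>Small enough that the leftover \<open>m\<^sup>2\<close> costs at most half of
    the weighted dissipation.\<close>
  define e where "e = 1 / (beta\<^sup>2 * N * (Q * P + 1))"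
  have pos: "0 < beta\<^sup>2 * N * (Q * P + 1)"
    using beta_pos N Q P by (simp add: add_nonneg_pos)
  then have e: "0 < e" by (simp add: e_def)
  have e_small: "e * N * beta * (Q * P) \<le> 1 / beta"
  proof -
    have "e * N * beta * (Q * P) \<le> e * N * beta * (Q * P + 1)"
      using e N beta_pos by (intro mult_left_mono) auto
    also have "\<dots> = 1 / beta"
    proof -
      have "Q * P + 1 \<noteq> 0" using mult_nonneg_nonneg[OF Q less_imp_le[OF P]] by linarith
      then show ?thesis
        using N beta_pos by (simp add: e_def power2_eq_square)
    qed
    finally show ?thesis .
  qed
  \<comment> \<open>Bounds the energy of the \<open>h^i\<close> by that of the \<open>f^i\<close>,
    through \<open>h^i = f^i + beta m x\<close> and the bound on \<open>m\<^sup>2\<close>.\<close>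
  define G where "G = 2 + 2 * beta\<^sup>2 * v * (A + N * e) * Q"
  have G: "0 < G" using A_pos v_nonneg N e Q by (simp add: G_def add_pos_nonneg)
  define r where "r = 1 / (beta * P * G)"
  have r: "0 < r" using beta_pos P G by (simp add: r_def)
  have main: "(\<Sum>i\<in>UNIV. (w i + e) * (2 * ip nu (h i) (k i)))
         - beta * (2 * m * (\<Sum>j\<in>UNIV. w j * ip nu (k j) (\<lambda>x. x)))
       \<le> - r * ((\<Sum>i\<in>UNIV. (w i + e) * ip nu (h i) (h i)) - beta * m\<^sup>2)"
    if m: "m = (\<Sum>j\<in>UNIV. w j * ip nu (h j) (\<lambda>x. x))"
      and h: "\<And>i. sq_integrable nu (h i)" and mean: "\<And>i. ip nu (h i) (\<lambda>x. 1) = 0"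
      and g: "\<And>i. gen (\<lambda>x. h i x - beta * m * x) (f' i) (k i)"
    for h f' k :: "'m \<Rightarrow> real \<Rightarrow> real" and m
  proof -
    define f where "f i = (\<lambda>x. h i x - beta * m * x)" for i
    define D where "D i = - beta * ip nu (f i) (k i)" for i
    have gf: "gen (f i) (f' i) (k i)" for i using g by (simp add: f_def)
    have k: "sq_integrable nu (k i)" and fL: "sq_integrable nu (f i)" for i
      using gf by (auto simp: gen_def)
    have mx: "sq_integrable nu (\<lambda>x. beta * m * x)"
      by (intro sq_integrable_scale sq_integrable_id)
    have D0: "0 \<le> D i" for i using gen_dissipation_nonneg[OF gf] by (simp add: D_def)
    have hf: "h i = (\<lambda>x. f i x + beta * m * x)" for i by (simp add: f_def)
    have ip_hk: "ip nu (h i) (k i) = ip nu (f i) (k i) + beta * m * ip nu (\<lambda>x. x) (k i)" for i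
      using ip_add_left[OF fL mx k] by (simp add: hf ip_scale_left)
    have "ip nu (f i) (\<lambda>x. 1) = 0" for i
      unfolding f_def using ip_diff_left[OF h mx sq_integrable_const[of 1]] mean
      by (simp add: ip_scale_left ip_id_one)
    then have ff: "ip nu (f i) (f i) \<le> P * D i" for i
      using Poincare[OF gf] by (simp add: D_def)
    have "ip nu (f i) (\<lambda>x. x) = ip nu (h i) (\<lambda>x. x) - beta * m * v" for i
      unfolding f_def using ip_diff_left[OF h mx sq_integrable_id]
      by (simp add: ip_scale_left v_def)
    then have "(\<Sum>j\<in>UNIV. w j * ip nu (f j) (\<lambda>x. x)) = m - A * (beta * m * v)"
      by (simp add: right_diff_distrib sum_subtractf m[symmetric] sum_distrib_right[symmetric] w(2))
    also have "\<dots> = \<kappa> * m" by (simp add: \<kappa>_def algebra_simps)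
    finally have \<kappa>m: "(\<Sum>j\<in>UNIV. w j * ip nu (f j) (\<lambda>x. x)) = \<kappa> * m" .
    define Sf where "Sf = (\<Sum>j\<in>UNIV. w j * ip nu (f j) (f j))"
    have mQ: "m\<^sup>2 \<le> Q * Sf"
    proof -
      \<comment> \<open>Splitting each weight into square roots yields the factor \<open>A\<close>,
        the total weight, and tolerates zero weights.\<close>
      have "(\<Sum>j\<in>UNIV. sqrt (w j) * (sqrt (w j) * ip nu (f j) (\<lambda>x. x)))\<^sup>2
          \<le> (\<Sum>j\<in>UNIV. (sqrt (w j))\<^sup>2) * (\<Sum>j\<in>UNIV. (sqrt (w j) * ip nu (f j) (\<lambda>x. x))\<^sup>2)"
        by (rule Cauchy_Schwarz_ineq_sum)
      then have "(\<kappa> * m)\<^sup>2 \<le> A * (\<Sum>j\<in>UNIV. w j * (ip nu (f j) (\<lambda>x. x))\<^sup>2)"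
        by (simp add: mult.assoc[symmetric] w \<kappa>m power_mult_distrib)
      also have "\<dots> \<le> A * (\<Sum>j\<in>UNIV. w j * (ip nu (f j) (f j) * v))"
        unfolding v_def using A_pos w(1)
        by (intro mult_left_mono sum_mono ip_Cauchy_Schwarz fL sq_integrable_id) auto
      also have "\<dots> = A * v * Sf" by (simp add: Sf_def sum_distrib_left mult_ac)
      finally show ?thesis
        using \<kappa> by (simp add: Q_def power_mult_distrib field_simps)
    qed
    define SD where "SD = (\<Sum>i\<in>UNIV. w i * D i)"
    define TD where "TD = (\<Sum>i\<in>UNIV. D i)"
    have SfD: "Sf \<le> P * SD"
      unfolding Sf_def SD_def sum_distrib_left
      using mult_left_mono[OF ff w(1)] by (intro sum_mono) (simp add: mult.left_commute)
    have cross: "2 * e * m * (beta * ip nu (\<lambda>x. x) (k i)) \<le> e * (D i / beta + beta * m\<^sup>2)" for i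
    proof -
      define y where "y = beta * ip nu (\<lambda>x. x) (k i)"
      have y: "y\<^sup>2 \<le> D i" using gen_first_moment[OF gf] by (simp add: y_def D_def)
      have "0 \<le> (y - beta * m)\<^sup>2 / beta" using beta_pos by simp
      also have "\<dots> = y\<^sup>2 / beta + beta * m\<^sup>2 - 2 * m * y"
        using beta_pos by (simp add: field_simps power2_eq_square)
      also have "\<dots> \<le> D i / beta + beta * m\<^sup>2 - 2 * m * y"
        using y beta_pos by (simp add: divide_right_mono)
      finally have "e * (2 * m * y) \<le> e * (D i / beta + beta * m\<^sup>2)"
        using e by (intro mult_left_mono) auto
      then show ?thesis by (simp add: y_def mult_ac)
    qed
    have "(\<Sum>i\<in>UNIV. (w i + e) * (2 * ip nu (h i) (k i)))
         - beta * (2 * m * (\<Sum>j\<in>UNIV. w j * ip nu (k j) (\<lambda>x. x)))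
      = (\<Sum>i\<in>UNIV. - (2 / beta) * ((w i + e) * D i) + 2 * e * m * (beta * ip nu (\<lambda>x. x) (k i)))"
    proof -
      have "(w i + e) * (2 * ip nu (h i) (k i)) - beta * (2 * m * (w i * ip nu (k i) (\<lambda>x. x)))
        = - (2 / beta) * ((w i + e) * D i) + 2 * e * m * (beta * ip nu (\<lambda>x. x) (k i))" for i
        using beta_pos by (simp add: ip_hk D_def ip_commute[of nu "k i"] algebra_simps)
      then show ?thesis
        by (simp add: sum_distrib_left sum_subtractf[symmetric])
    qed
    also have "\<dots> \<le> (\<Sum>i\<in>UNIV. - (2 / beta) * ((w i + e) * D i) + e * (D i / beta + beta * m\<^sup>2))"
      by (intro sum_mono add_left_mono cross)
    also have "\<dots> = (\<Sum>i\<in>UNIV. - (2 / beta) * (w i * D i) - e / beta * D i + e * beta * m\<^sup>2)"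
      using beta_pos by (intro sum.cong refl) (simp add: algebra_simps)
    also have "\<dots> = - (2 / beta) * SD - e / beta * TD + N * e * beta * m\<^sup>2"
      by (simp add: sum.distrib sum_subtractf SD_def TD_def N_def sum_distrib_left)
    also have "N * e * beta * m\<^sup>2 \<le> 1 / beta * SD"
    proof -
      have "m\<^sup>2 \<le> Q * (P * SD)"
        using mQ SfD Q mult_left_mono[of Sf "P * SD" Q] by linarith
      then have "N * e * beta * m\<^sup>2 \<le> N * e * beta * (Q * (P * SD))"
        using N e beta_pos by (intro mult_left_mono) auto
      also have "\<dots> = e * N * beta * (Q * P) * SD" by (simp add: mult_ac)
      also have "\<dots> \<le> 1 / beta * SD"
        using w(1) D0 by (intro mult_right_mono e_small) (simp add: SD_def sum_nonneg)
      finally show ?thesis .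
    qed
    also have "- (2 / beta) * SD - e / beta * TD + 1 / beta * SD = - (1 / beta) * (SD + e * TD)"
      by (simp add: algebra_simps)
    finally have diss: "(\<Sum>i\<in>UNIV. (w i + e) * (2 * ip nu (h i) (k i)))
         - beta * (2 * m * (\<Sum>j\<in>UNIV. w j * ip nu (k j) (\<lambda>x. x))) \<le> - (1 / beta) * (SD + e * TD)"
      by simp
    define F where "F = (\<Sum>i\<in>UNIV. (w i + e) * ip nu (f i) (f i))"
    have "F \<le> (\<Sum>i\<in>UNIV. (w i + e) * (P * D i))"
      unfolding F_def using w(1) e ff by (intro sum_mono mult_left_mono) (auto simp: add_nonneg_nonneg less_imp_le)
    also have "\<dots> = P * (SD + e * TD)"
      by (simp add: SD_def TD_def distrib_right sum.distrib sum_distrib_left distrib_left mult_ac)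
    finally have FD: "F \<le> P * (SD + e * TD)" .
    have SfF: "Sf \<le> F"
      unfolding F_def Sf_def using e by (intro sum_mono mult_right_mono ip_self_nonneg) auto
    have "ip nu (h i) (h i) \<le> 2 * ip nu (f i) (f i) + 2 * (beta\<^sup>2 * v * m\<^sup>2)" for i
    proof -
      have "ip nu (\<lambda>x. beta * m * x) (\<lambda>x. beta * m * x) = beta\<^sup>2 * v * m\<^sup>2"
        by (simp only: ip_scale_left ip_scale_right v_def[symmetric])
           (simp add: power2_eq_square)
      then show ?thesis
        using ip_self_add_le[OF fL[of i] mx] by (simp only: hf[of i, symmetric])
    qed
    then have "(\<Sum>i\<in>UNIV. (w i + e) * ip nu (h i) (h i))
        \<le> (\<Sum>i\<in>UNIV. (w i + e) * (2 * ip nu (f i) (f i) + 2 * (beta\<^sup>2 * v * m\<^sup>2)))"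
      using w(1) e by (intro sum_mono mult_left_mono) (auto simp: add_nonneg_nonneg less_imp_le)
    also have "\<dots> = 2 * F + (A + N * e) * (2 * (beta\<^sup>2 * v * m\<^sup>2))"
    proof -
      have "(w i + e) * (2 * ip nu (f i) (f i) + 2 * (beta\<^sup>2 * v * m\<^sup>2))
          = 2 * ((w i + e) * ip nu (f i) (f i)) + (w i + e) * (2 * (beta\<^sup>2 * v * m\<^sup>2))" for i
        by (simp only: distrib_left mult.left_commute)
      moreover have "(\<Sum>i\<in>UNIV. w i + e) = A + N * e"
        by (simp add: sum.distrib w(2) N_def)
      ultimately show ?thesis
        by (simp only: sum.distrib sum_distrib_left[symmetric] sum_distrib_right[symmetric] F_def)
    qed
    also have "\<dots> \<le> 2 * F + (A + N * e) * (2 * (beta\<^sup>2 * v * (Q * F)))"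
    proof -
      have "m\<^sup>2 \<le> Q * F" using mQ SfF Q mult_left_mono[of Sf F Q] by linarith
      then show ?thesis
        using A_pos N e v_nonneg by (intro add_left_mono mult_left_mono) auto
    qed
    also have "\<dots> = G * F" by (simp add: G_def algebra_simps)
    finally have "(\<Sum>i\<in>UNIV. (w i + e) * ip nu (h i) (h i)) - beta * m\<^sup>2 \<le> G * F"
      using mult_nonneg_nonneg[OF less_imp_le[OF beta_pos] zero_le_power2[of m]] by linarith
    then have "r * ((\<Sum>i\<in>UNIV. (w i + e) * ip nu (h i) (h i)) - beta * m\<^sup>2) \<le> r * (G * (P * (SD + e * TD)))"
      using mult_left_mono[OF FD less_imp_le[OF G]] r by (intro mult_left_mono) linarith+
    also have "\<dots> = 1 / beta * (SD + e * TD)"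
      using beta_pos P G by (simp add: r_def)
    finally show ?thesis using diss by simp
  qed
  show ?thesis using that[OF e r] main by blast
qed

text \<open>Cauchy-Schwarz bounds \<open>beta * m\<^sup>2\<close> by \<open>A * beta * v\<close>
  times the weighted square. Subcriticality therefore makes the part of the energy without
  \<open>e\<close> nonnegative, and \<open>e\<close> alone supplies the lower bound for every
  species.\<close>

lemma energy_bounds:
  fixes w :: "'m::finite \<Rightarrow> real" and h :: "'m \<Rightarrow> real \<Rightarrow> real"
  assumes w: "\<And>i. 0 \<le> w i" "(\<Sum>i\<in>UNIV. w i) = A" and sub: "A * beta * v < 1"
    and h: "\<And>i. sq_integrable nu (h i)"
    and m: "m = (\<Sum>j\<in>UNIV. w j * ip nu (h j) (\<lambda>x. x))"
  shows "e * (\<Sum>i\<in>UNIV. ip nu (h i) (h i)) \<le> (\<Sum>i\<in>UNIV. (w i + e) * ip nu (h i) (h i)) - beta * m\<^sup>2"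
    and "(\<Sum>i\<in>UNIV. (w i + e) * ip nu (h i) (h i)) - beta * m\<^sup>2 \<le> (A + e) * (\<Sum>i\<in>UNIV. ip nu (h i) (h i))"
proof -
  define S where "S = (\<Sum>j\<in>UNIV. w j * ip nu (h j) (h j))"
  have S: "0 \<le> S" unfolding S_def using w(1) by (intro sum_nonneg mult_nonneg_nonneg ip_self_nonneg)
  have eq: "(\<Sum>i\<in>UNIV. (w i + e) * ip nu (h i) (h i)) = S + e * (\<Sum>i\<in>UNIV. ip nu (h i) (h i))"
    by (simp add: S_def distrib_right sum.distrib sum_distrib_left)
  have "(\<Sum>j\<in>UNIV. sqrt (w j) * (sqrt (w j) * ip nu (h j) (\<lambda>x. x)))\<^sup>2
      \<le> (\<Sum>j\<in>UNIV. (sqrt (w j))\<^sup>2) * (\<Sum>j\<in>UNIV. (sqrt (w j) * ip nu (h j) (\<lambda>x. x))\<^sup>2)"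
    by (rule Cauchy_Schwarz_ineq_sum)
  then have "m\<^sup>2 \<le> A * (\<Sum>j\<in>UNIV. w j * (ip nu (h j) (\<lambda>x. x))\<^sup>2)"
    by (simp add: mult.assoc[symmetric] w m power_mult_distrib)
  also have "\<dots> \<le> A * (\<Sum>j\<in>UNIV. w j * (ip nu (h j) (h j) * v))"
    unfolding v_def using A_pos w(1)
    by (intro mult_left_mono sum_mono ip_Cauchy_Schwarz h sq_integrable_id) auto
  also have "\<dots> = A * v * S" by (simp add: S_def sum_distrib_left mult_ac)
  finally have "beta * m\<^sup>2 \<le> beta * (A * v * S)"
    using beta_pos by (intro mult_left_mono) auto
  also have "\<dots> = A * beta * v * S" by simp
  also have "\<dots> \<le> 1 * S" using sub S by (intro mult_right_mono) auto
  finally have "beta * m\<^sup>2 \<le> S" by simp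
  then show "e * (\<Sum>i\<in>UNIV. ip nu (h i) (h i)) \<le> (\<Sum>i\<in>UNIV. (w i + e) * ip nu (h i) (h i)) - beta * m\<^sup>2"
    by (simp add: eq)
  have "w i \<le> A" for i
    unfolding w(2)[symmetric] using w(1) by (intro member_le_sum) auto
  then have "S \<le> A * (\<Sum>i\<in>UNIV. ip nu (h i) (h i))"
    unfolding S_def sum_distrib_left by (intro sum_mono mult_right_mono ip_self_nonneg)
  then show "(\<Sum>i\<in>UNIV. (w i + e) * ip nu (h i) (h i)) - beta * m\<^sup>2 \<le> (A + e) * (\<Sum>i\<in>UNIV. ip nu (h i) (h i))"
    using mult_nonneg_nonneg[OF less_imp_le[OF beta_pos] zero_le_power2[of m]]
    unfolding eq distrib_right[of A e] by linarith
qed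

lemma exponential_decay:
  fixes w :: "'m::finite \<Rightarrow> real"
  assumes w: "\<And>i. 0 \<le> w i" "(\<Sum>i\<in>UNIV. w i) = A" and sub: "A * beta * v < 1"
  obtains C r where "0 < C" "0 < r" and
    "\<And>h f' k t. (\<And>t i. 0 \<le> t \<Longrightarrow> sq_integrable nu (h t i)) \<Longrightarrow>
       ((\<lambda>t. \<Sum>i\<in>UNIV. ip nu (\<lambda>x. h t i x - h 0 i x) (\<lambda>x. h t i x - h 0 i x)) \<longlongrightarrow> 0) (at_right 0) \<Longrightarrow>
       (\<And>t i. 0 < t \<Longrightarrow>
          gen (\<lambda>x. h t i x - beta * (\<Sum>j\<in>UNIV. w j * ip nu (h t j) (\<lambda>x. x)) * x) (f' t i) (k t i)) \<Longrightarrow>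
       (\<And>t. 0 < t \<Longrightarrow>
          ((\<lambda>r. \<Sum>i\<in>UNIV. ip nu (\<lambda>x. (h r i x - h t i x) / (r - t) - k t i x)
                              (\<lambda>x. (h r i x - h t i x) / (r - t) - k t i x)) \<longlongrightarrow> 0) (at t)) \<Longrightarrow>
       (\<And>i. ip nu (h 0 i) (\<lambda>x. 1) = 0) \<Longrightarrow> 0 \<le> t \<Longrightarrow>
       (\<Sum>i\<in>UNIV. ip nu (h t i) (h t i)) \<le> C * exp (- r * t) * (\<Sum>i\<in>UNIV. ip nu (h 0 i) (h 0 i))"
proof -
  obtain e r where e: "0 < e" and r: "0 < r" and diss:
    "\<And>h f' k m. m = (\<Sum>j\<in>UNIV. w j * ip nu (h j) (\<lambda>x. x)) \<Longrightarrow>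
       (\<And>i. sq_integrable nu (h i)) \<Longrightarrow>
       (\<And>i. ip nu (h i) (\<lambda>x. 1) = 0) \<Longrightarrow>
       (\<And>i. gen (\<lambda>x. h i x - beta * m * x) (f' i) (k i)) \<Longrightarrow>
       (\<Sum>i\<in>UNIV. (w i + e) * (2 * ip nu (h i) (k i)))
         - beta * (2 * m * (\<Sum>j\<in>UNIV. w j * ip nu (k j) (\<lambda>x. x)))
       \<le> - r * ((\<Sum>i\<in>UNIV. (w i + e) * ip nu (h i) (h i)) - beta * m\<^sup>2)"
    using energy_dissipation[OF w sub] by blast
  define C where "C = (A + e) / e"
  have C: "1 \<le> C" using A_pos e by (simp add: C_def)
  have main: "(\<Sum>i\<in>UNIV. ip nu (h t i) (h t i)) \<le> C * exp (- r * t) * (\<Sum>i\<in>UNIV. ip nu (h 0 i) (h 0 i))"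
    if h: "\<And>t i. 0 \<le> t \<Longrightarrow> sq_integrable nu (h t i)"
      and init: "((\<lambda>t. \<Sum>i\<in>UNIV. ip nu (\<lambda>x. h t i x - h 0 i x) (\<lambda>x. h t i x - h 0 i x)) \<longlongrightarrow> 0) (at_right 0)"
      and g: "\<And>t i. 0 < t \<Longrightarrow>
          gen (\<lambda>x. h t i x - beta * (\<Sum>j\<in>UNIV. w j * ip nu (h t j) (\<lambda>x. x)) * x) (f' t i) (k t i)"
      and evol: "\<And>t. 0 < t \<Longrightarrow>
          ((\<lambda>r. \<Sum>i\<in>UNIV. ip nu (\<lambda>x. (h r i x - h t i x) / (r - t) - k t i x)
                              (\<lambda>x. (h r i x - h t i x) / (r - t) - k t i x)) \<longlongrightarrow> 0) (at t)"
      and mean0: "\<And>i. ip nu (h 0 i) (\<lambda>x. 1) = 0" and "0 \<le> t"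
    for h f' k :: "real \<Rightarrow> 'm \<Rightarrow> real \<Rightarrow> real" and t
  proof (cases "t = 0")
    case True
    have "0 \<le> (\<Sum>i\<in>UNIV. ip nu (h 0 i) (h 0 i))" by (intro sum_nonneg ip_self_nonneg)
    then show ?thesis using True mult_right_mono[OF C] by simp
  next
    case False
    then have "0 < t" using \<open>0 \<le> t\<close> by simp
    have k: "sq_integrable nu (k t i)" if "0 < t" for t i
      using g[OF that] by (simp add: gen_def)
    have ev: "\<forall>\<^sub>F r in at t. sq_integrable nu (h r i)" if "0 < t" for t i
      using eventually_at_in_open'[of "{0<..}" t] that
      by (auto elim!: eventually_mono intro!: h)
    have ev0: "\<forall>\<^sub>F r in at_right 0. sq_integrable nu (h r i)" for i
      using eventually_at_right_less[of 0] by eventually_elim (auto intro: h)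
    have init_i: "((\<lambda>t. ip nu (\<lambda>x. h t i x - h 0 i x) (\<lambda>x. h t i x - h 0 i x)) \<longlongrightarrow> 0) (at_right 0)" for i
      by (rule tendsto_zero_sum_component[OF init]) (auto simp: ip_self_nonneg)
    have evol_i: "((\<lambda>r. ip nu (\<lambda>x. (h r i x - h t i x) / (r - t) - k t i x)
         (\<lambda>x. (h r i x - h t i x) / (r - t) - k t i x)) \<longlongrightarrow> 0) (at t)" if "0 < t" for t i
      by (rule tendsto_zero_sum_component[OF evol[OF that]]) (auto simp: ip_self_nonneg)
    note D_lin = has_derivative_ip_curve(1)[OF ev h[OF less_imp_le] k _ evol_i]
    note D_sq = has_derivative_ip_curve(2)[OF ev h[OF less_imp_le] k sq_integrable_id evol_i]
    note L_lin = tendsto_ip_curve(1)[OF ev0 h[OF order_refl] _ init_i]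
    note L_sq = tendsto_ip_curve(2)[OF ev0 h[OF order_refl] sq_integrable_id init_i]
    \<comment> \<open>Zero mass propagates: the mass has derivative zero, and the one-sided bound is
      applied to it and to its negative.\<close>
    have mean: "ip nu (h t i) (\<lambda>x. 1) = 0" if "0 < t" for t i
    proof (rule antisym)
      have D: "((\<lambda>r. ip nu (h r i) (\<lambda>x. 1)) has_real_derivative 0) (at t)" if "0 < t" for t
        using D_lin[OF that that that sq_integrable_const[of 1] that, of i] gen_mean[OF g[OF that, of i]]
        by (simp add: ip_commute)
      have L: "((\<lambda>r. ip nu (h r i) (\<lambda>x. 1)) \<longlongrightarrow> 0) (at_right 0)"
        using L_lin[OF sq_integrable_const[of 1], of i] mean0 by simp
      show "ip nu (h t i) (\<lambda>x. 1) \<le> 0"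
        using nonincreasing_limit_bound[OF D _ L that] by simp
      have D': "((\<lambda>r. - ip nu (h r i) (\<lambda>x. 1)) has_real_derivative 0) (at t)" if "0 < t" for t
        using DERIV_minus[OF D[OF that]] by simp
      have L': "((\<lambda>r. - ip nu (h r i) (\<lambda>x. 1)) \<longlongrightarrow> 0) (at_right 0)"
        using tendsto_minus[OF L] by simp
      show "0 \<le> ip nu (h t i) (\<lambda>x. 1)"
        using nonincreasing_limit_bound[OF D' _ L' that] by simp
    qed
    define m where "m t = (\<Sum>j\<in>UNIV. w j * ip nu (h t j) (\<lambda>x. x))" for t
    define m' where "m' t = (\<Sum>j\<in>UNIV. w j * ip nu (k t j) (\<lambda>x. x))" for t
    define E where "E t = (\<Sum>i\<in>UNIV. (w i + e) * ip nu (h t i) (h t i)) - beta * (m t)\<^sup>2" for t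
    define E' where "E' t = (\<Sum>i\<in>UNIV. (w i + e) * (2 * ip nu (h t i) (k t i))) - beta * (2 * m t * m' t)" for t
    have Dm: "(m has_real_derivative m' t) (at t)" if "0 < t" for t
      unfolding m_def[abs_def] m'_def
      by (intro DERIV_sum DERIV_cmult D_lin that sq_integrable_id)
    have DE: "(E has_real_derivative E' t) (at t)" if "0 < t" for t
    proof -
      have "((\<lambda>t. (m t)\<^sup>2) has_real_derivative 2 * m t * m' t) (at t)"
        using DERIV_power[OF Dm[OF that], of 2] by (simp add: mult_ac)
      then show ?thesis
        unfolding E_def[abs_def] E'_def
        by (intro DERIV_diff DERIV_sum DERIV_cmult D_sq that)
    qed
    have E'_le: "E' t \<le> - r * E t" if "0 < t" for t
      unfolding E_def E'_def m'_def
      using g[OF that] h[of t] mean[OF that] that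
      by (intro diss[where f' = "f' t"]) (auto simp: m_def)
    have LE: "(E \<longlongrightarrow> E 0) (at_right 0)"
      unfolding E_def[abs_def] m_def
      by (intro tendsto_intros L_sq L_lin sq_integrable_id)
    \<comment> \<open>Gronwall's inequality by an integrating factor, started from the limit at time
      zero.\<close>
    have "exp (r * t) * E t \<le> E 0"
    proof (rule nonincreasing_limit_bound[where g = "\<lambda>t. exp (r * t) * E t" and t = t])
      show "((\<lambda>t. exp (r * t) * E t) has_real_derivative exp (r * t) * (r * E t + E' t)) (at t)"
        if "0 < t" for t
      proof -
        have "((\<lambda>t. exp (r * t)) has_real_derivative exp (r * t) * r) (at t)"
          by (auto intro!: derivative_eq_intros)
        from DERIV_mult[OF this DE[OF that]] show ?thesis
          by (simp add: algebra_simps)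
      qed
      show "exp (r * t) * (r * E t + E' t) \<le> 0" if "0 < t" for t
        using E'_le[OF that] by (intro mult_nonneg_nonpos) auto
      have "((\<lambda>t. exp (r * t) * E t) \<longlongrightarrow> exp (r * 0) * E 0) (at_right 0)"
        by (intro tendsto_intros LE)
      then show "((\<lambda>t. exp (r * t) * E t) \<longlongrightarrow> E 0) (at_right 0)" by simp
    qed fact
    then have "exp (- (r * t)) * (exp (r * t) * E t) \<le> exp (- (r * t)) * E 0"
      by (intro mult_left_mono) auto
    then have Et: "E t \<le> exp (- (r * t)) * E 0"
      by (simp add: mult.assoc[symmetric] exp_minus)
    have "e * (\<Sum>i\<in>UNIV. ip nu (h t i) (h t i)) \<le> E t"
      unfolding E_def using energy_bounds(1)[OF w sub h[OF \<open>0 \<le> t\<close>] m_def] .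
    also note Et
    also have "E 0 \<le> (A + e) * (\<Sum>i\<in>UNIV. ip nu (h 0 i) (h 0 i))"
      unfolding E_def using energy_bounds(2)[OF w sub h[OF order_refl] m_def] .
    then have "exp (- (r * t)) * E 0 \<le> exp (- (r * t)) * ((A + e) * (\<Sum>i\<in>UNIV. ip nu (h 0 i) (h 0 i)))"
      by (intro mult_left_mono) auto
    finally have "(\<Sum>i\<in>UNIV. ip nu (h t i) (h t i))
        \<le> exp (- (r * t)) * ((A + e) * (\<Sum>i\<in>UNIV. ip nu (h 0 i) (h 0 i))) / e"
      using e by (simp add: pos_le_divide_eq mult.commute)
    then show ?thesis by (simp add: C_def mult_ac)
  qed
  have "0 < C" using C by simp
  from that[OF this r] main show ?thesis by blast
qed

section \<open>The linearized operator\<close>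

lemma in_L2_iff: "in_L2 rho h \<longleftrightarrow> sq_integrable nu h"
  by (simp add: in_L2_def sq_integrable_def)

lemma perturbation_norm_eq:
  "perturbation_norm rho \<mu> = sqrt (\<Sum>i\<in>UNIV. ip nu (\<lambda>x. \<mu> i x / rho x) (\<lambda>x. \<mu> i x / rho x))"
  by (simp add: perturbation_norm_def L2_norm_def ip_def power2_eq_square)

lemma first_moment_eq:
  assumes "sq_integrable nu (\<lambda>x. f x / rho x)"
  shows "first_moment f = ip nu (\<lambda>x. f x / rho x) (\<lambda>x. x)"
proof -
  have "(\<lambda>x. f x / rho x) \<in> borel_measurable borel"
    using assms by (simp add: sq_integrable_nu)
  then show ?thesis by (subst ip_nu) (auto simp: first_moment_def mult.commute)
qed

lemma mass_eq:
  assumes "sq_integrable nu (\<lambda>x. f x / rho x)"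
  shows "mass f = ip nu (\<lambda>x. f x / rho x) (\<lambda>x. 1)"
proof -
  have "(\<lambda>x. f x / rho x) \<in> borel_measurable borel"
    using assms by (simp add: sq_integrable_nu)
  then show ?thesis by (subst ip_nu) (auto simp: mass_def)
qed

lemma deriv_Vbar: "deriv Vbar x = x ^ 3 - x"
  unfolding Vbar_def[abs_def]
  by (rule DERIV_imp_deriv) (auto intro!: derivative_eq_intros simp: field_simps)

text \<open>The stationary state is even, so its first moment vanishes and the drift collapses to
  \<open>dU\<close>.\<close>

lemma lin_op_eq:
  assumes "abar a al = A"
  shows "lin_op a al s \<mu> i x =
    deriv (\<lambda>y. dU y * \<mu> i y - (\<Sum>j\<in>UNIV. a j * al j * first_moment (\<mu> j)) * rho y) x
      + 1 / beta * deriv (deriv (\<mu> i)) x"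
proof -
  have fm: "first_moment rho = 0" by (simp add: first_moment_def integral_odd_rho)
  have "(\<Sum>j\<in>UNIV. a j * al j * (y - first_moment rho)) = A * y" for y
    using sum_distrib_right[of "\<lambda>j. a j * al j" UNIV y] assms by (simp add: fm abar_def)
  then have "deriv Vbar y + (\<Sum>j\<in>UNIV. a j * al j * (y - first_moment rho)) = dU y" for y
    by (simp add: deriv_Vbar dU_def algebra_simps)
  then show ?thesis by (simp add: lin_op_def Let_def assms beta_def)
qed

lemma DERIV_dU_mult:
  assumes "(u has_real_derivative u') (at x)"
  shows "(\<lambda>y. dU y * u y) field_differentiable at x"
proof -
  have "((\<lambda>y. dU y * u y) has_real_derivative (3 * x\<^sup>2 + (A - 1)) * u x + u' * dU x) (at x)"
    unfolding dU_def[abs_def] using assms by (auto intro!: derivative_eq_intros)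
  then show ?thesis by (auto simp: field_differentiable_def)
qed

text \<open>With \<open>h\<^sup>i = \<mu>\<^sup>i / \<rho>\<close>, the linearized operator at \<open>\<mu>\<close> is the generator applied to
  \<open>f\<^sup>i = h\<^sup>i - \<beta> m x\<close>.\<close>

lemma lin_dom_gen:
  assumes A: "abar a al = A" and \<mu>: "\<mu> \<in> lin_dom a al s"
  defines "m \<equiv> (\<Sum>j\<in>UNIV. a j * al j * first_moment (\<mu> j))"
  shows "gen (\<lambda>x. \<mu> i x / rho x - beta * m * x)
             (\<lambda>x. (deriv (\<mu> i) x + beta * (dU x * \<mu> i x - m * rho x)) / rho x)
             (\<lambda>x. lin_op a al s \<mu> i x / rho x)"
proof -
  have d1: "(\<mu> i has_real_derivative deriv (\<mu> i) x) (at x)"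
    and d2: "(deriv (\<mu> i) has_real_derivative deriv (deriv (\<mu> i)) x) (at x)"
    and L2: "sq_integrable nu (\<lambda>x. \<mu> i x / rho x)"
      "sq_integrable nu (\<lambda>x. lin_op a al s \<mu> i x / rho x)" for x
    using \<mu> by (auto simp: lin_dom_def Let_def A in_L2_iff DERIV_deriv_iff_field_differentiable)
  \<comment> \<open>\<open>deriv\<close> is total; differentiability has to be shown before its
    value can be used as a derivative.\<close>
  have d3: "((\<lambda>y. dU y * \<mu> i y - m * rho y) has_real_derivative
      deriv (\<lambda>y. dU y * \<mu> i y - m * rho y) x) (at x)" for x
    unfolding DERIV_deriv_iff_field_differentiable
    using DERIV_rho[of x]
    by (intro field_differentiable_diff DERIV_dU_mult[OF d1] field_differentiable_mult
          field_differentiable_const) (auto simp: field_differentiable_def)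
  have "((\<lambda>x. \<mu> i x / rho x - beta * m * x) has_real_derivative
      (deriv (\<mu> i) x * rho x - \<mu> i x * (- beta * dU x * rho x)) / (rho x * rho x) - beta * m) (at x)" for x
    using DERIV_diff[OF DERIV_divide[OF d1[of x] DERIV_rho[of x]] DERIV_cmult[OF DERIV_ident, of "beta * m"]]
    by simp
  moreover have "(deriv (\<mu> i) x * rho x - \<mu> i x * (- beta * dU x * rho x)) / (rho x * rho x) - beta * m
      = (deriv (\<mu> i) x + beta * (dU x * \<mu> i x - m * rho x)) / rho x" for x
    by (simp add: field_simps)
  moreover have "((\<lambda>x. rho x * ((deriv (\<mu> i) x + beta * (dU x * \<mu> i x - m * rho x)) / rho x))
      has_real_derivative beta * (rho x * (lin_op a al s \<mu> i x / rho x))) (at x)" for x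
  proof -
    have cancel: "rho y * (z / rho y) = z" for y z by simp
    show ?thesis
      using DERIV_add[OF d2[of x] DERIV_cmult[OF d3[of x], of beta]] beta_pos
      unfolding cancel lin_op_eq[OF A] m_def[symmetric]
      by (simp add: distrib_left add.commute)
  qed
  moreover have "sq_integrable nu (\<lambda>x. \<mu> i x / rho x - beta * m * x)"
    by (intro sq_integrable_diff sq_integrable_scale sq_integrable_id L2)
  ultimately show ?thesis
    using L2(2) by (simp add: gen_def)
qed

lemma lin_solution_decay:
  fixes a al :: "'m::finite \<Rightarrow> real"
  assumes A: "abar a al = A" and w: "\<And>i. 0 \<le> a i * al i" and sub: "A * beta * v < 1"
  shows "\<exists>C>0. \<exists>r>0. \<forall>\<mu>. lin_solution a al s \<mu> \<and> (\<forall>i. mass (\<mu> 0 i) = 0) \<longrightarrow>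
     (\<forall>t\<ge>0. perturbation_norm rho (\<mu> t) \<le> C * exp (- r * t) * perturbation_norm rho (\<mu> 0))"
proof -
  obtain C r where C: "0 < C" and r: "0 < r" and decay:
    "\<And>h f' k t. (\<And>t i. 0 \<le> t \<Longrightarrow> sq_integrable nu (h t i)) \<Longrightarrow>
       ((\<lambda>t. \<Sum>i\<in>UNIV. ip nu (\<lambda>x. h t i x - h 0 i x) (\<lambda>x. h t i x - h 0 i x)) \<longlongrightarrow> 0) (at_right 0) \<Longrightarrow>
       (\<And>t i. 0 < t \<Longrightarrow>
          gen (\<lambda>x. h t i x - beta * (\<Sum>j\<in>UNIV. (a j * al j) * ip nu (h t j) (\<lambda>x. x)) * x) (f' t i) (k t i)) \<Longrightarrow>
       (\<And>t. 0 < t \<Longrightarrow>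
          ((\<lambda>r. \<Sum>i\<in>UNIV. ip nu (\<lambda>x. (h r i x - h t i x) / (r - t) - k t i x)
                              (\<lambda>x. (h r i x - h t i x) / (r - t) - k t i x)) \<longlongrightarrow> 0) (at t)) \<Longrightarrow>
       (\<And>i. ip nu (h 0 i) (\<lambda>x. 1) = 0) \<Longrightarrow> 0 \<le> t \<Longrightarrow>
       (\<Sum>i\<in>(UNIV::'m set). ip nu (h t i) (h t i)) \<le> C * exp (- r * t) * (\<Sum>i\<in>UNIV. ip nu (h 0 i) (h 0 i))"
    using exponential_decay[of "\<lambda>i. a i * al i", OF w _ sub] A unfolding abar_def by blast
  \<comment> \<open>The energy estimate concerns squared norms, hence the square root of
    \<open>C\<close> and half the rate.\<close>
  have "perturbation_norm rho (\<mu> t) \<le> sqrt C * exp (- (r / 2) * t) * perturbation_norm rho (\<mu> 0)"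
    if sol: "lin_solution a al s \<mu>" and mass: "\<And>i. mass (\<mu> 0 i) = 0" and "0 \<le> t" for \<mu> and t :: real
  proof -
    define h where "h t i x = \<mu> t i x / rho x" for t i x
    have h: "sq_integrable nu (h t i)" if "0 \<le> t" for t i
      using sol that by (simp add: lin_solution_def Let_def A in_L2_iff h_def[abs_def])
    have "((\<lambda>t. perturbation_norm rho (\<lambda>i x. \<mu> t i x - \<mu> 0 i x)) \<longlongrightarrow> 0) (at_right 0)"
      using sol by (simp add: lin_solution_def Let_def A)
    from tendsto_power[OF this, of 2]
    have init: "((\<lambda>t. \<Sum>i\<in>UNIV. ip nu (\<lambda>x. h t i x - h 0 i x) (\<lambda>x. h t i x - h 0 i x)) \<longlongrightarrow> 0) (at_right 0)"
      by (simp add: perturbation_norm_eq h_def diff_divide_distrib sum_nonneg ip_self_nonneg)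
    have dom: "\<mu> t \<in> lin_dom a al s" if "0 < t" for t
      using sol that by (simp add: lin_solution_def Let_def)
    have evol: "((\<lambda>r. \<Sum>i\<in>UNIV. ip nu (\<lambda>x. (h r i x - h t i x) / (r - t) - lin_op a al s (\<mu> t) i x / rho x)
          (\<lambda>x. (h r i x - h t i x) / (r - t) - lin_op a al s (\<mu> t) i x / rho x)) \<longlongrightarrow> 0) (at t)"
      if "0 < t" for t
    proof -
      have "((\<lambda>r. perturbation_norm rho
          (\<lambda>i x. (\<mu> r i x - \<mu> t i x) / (r - t) - lin_op a al s (\<mu> t) i x)) \<longlongrightarrow> 0) (at t)"
        using sol that by (simp add: lin_solution_def Let_def A)
      from tendsto_power[OF this, of 2]
      have "((\<lambda>r. \<Sum>i\<in>UNIV.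
          ip nu (\<lambda>x. ((\<mu> r i x - \<mu> t i x) / (r - t) - lin_op a al s (\<mu> t) i x) / rho x)
                (\<lambda>x. ((\<mu> r i x - \<mu> t i x) / (r - t) - lin_op a al s (\<mu> t) i x) / rho x)) \<longlongrightarrow> 0) (at t)"
        by (simp add: perturbation_norm_eq sum_nonneg ip_self_nonneg)
      moreover have "((\<mu> r i x - \<mu> t i x) / (r - t) - lin_op a al s (\<mu> t) i x) / rho x
          = (h r i x - h t i x) / (r - t) - lin_op a al s (\<mu> t) i x / rho x" for r i x
        by (simp add: h_def diff_divide_distrib mult.commute)
      ultimately show ?thesis by simp
    qed
    have "gen (\<lambda>x. h t i x - beta * (\<Sum>j\<in>UNIV. (a j * al j) * ip nu (h t j) (\<lambda>x. x)) * x)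
        (\<lambda>x. (deriv (\<mu> t i) x + beta * (dU x * \<mu> t i x
            - (\<Sum>j\<in>UNIV. a j * al j * first_moment (\<mu> t j)) * rho x)) / rho x)
        (\<lambda>x. lin_op a al s (\<mu> t) i x / rho x)" if "0 < t" for t i
      using lin_dom_gen[OF A dom[OF that], of i] h[of t] that
      by (simp add: first_moment_eq h_def[abs_def])
    moreover have "ip nu (h 0 i) (\<lambda>x. 1) = 0" for i
      using mass_eq[of "\<mu> 0 i"] h[of 0 i] mass[of i] by (simp add: h_def[abs_def])
    ultimately have "(\<Sum>i\<in>UNIV. ip nu (h t i) (h t i))
        \<le> C * exp (- r * t) * (\<Sum>i\<in>UNIV. ip nu (h 0 i) (h 0 i))"
      using h init evol \<open>0 \<le> t\<close>
      by (intro decay[where f' = "\<lambda>t i x. (deriv (\<mu> t i) x + beta * (dU x * \<mu> t i x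
            - (\<Sum>j\<in>UNIV. a j * al j * first_moment (\<mu> t j)) * rho x)) / rho x"
            and k = "\<lambda>t i x. lin_op a al s (\<mu> t) i x / rho x"]) blast+
    from real_sqrt_le_mono[OF this]
    have "perturbation_norm rho (\<mu> t) \<le> sqrt (C * exp (- r * t)) * perturbation_norm rho (\<mu> 0)"
      by (simp add: perturbation_norm_eq real_sqrt_mult h_def[abs_def])
    also have "sqrt (C * exp (- r * t)) = sqrt C * exp (- (r / 2) * t)"
    proof -
      have "exp (- r * t) = (exp (- (r / 2) * t))\<^sup>2"
        by (simp add: exp_double[symmetric])
      then show ?thesis by (simp add: real_sqrt_mult)
    qed
    finally show ?thesis .
  qed
  then show ?thesis
    using C r by (intro exI[of _ "sqrt C"] conjI exI[of _ "r / 2"]) auto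
qed

section \<open>Null space at the critical value\<close>

lemma affine_mult_rho_lin_op:
  fixes \<mu> :: "'m::finite \<Rightarrow> real \<Rightarrow> real"
  assumes A: "abar a al = A" and crit: "A * beta * v = 1"
    and \<mu>_def: "\<mu> = (\<lambda>i x. (c + d * x) * rho x)"
  shows "\<mu> \<in> lin_dom a al s" "lin_op a al s \<mu> i x = 0"
proof -
  define u where "u x = (c + d * x) * rho x" for x
  define u' where "u' x = d * rho x - beta * dU x * u x" for x
  have d1: "(u has_real_derivative u' x) (at x)" for x
    unfolding u_def[abs_def] u'_def
    by (auto intro!: derivative_eq_intros simp: algebra_simps)
  then have du: "deriv u = u'" by (auto intro: DERIV_imp_deriv)
  have d2: "u' field_differentiable at x" for x
  proof -
    have "(\<lambda>x. d * rho x - beta * (dU x * u x)) field_differentiable at x"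
      using DERIV_rho[of x]
      by (intro field_differentiable_diff field_differentiable_mult[OF field_differentiable_const]
            DERIV_dU_mult[OF d1]) (auto simp: field_differentiable_def)
    then show ?thesis by (simp add: u'_def[abs_def] mult.assoc)
  qed
  have L2: "sq_integrable nu (\<lambda>x. c + d * x)"
    by (intro sq_integrable_add sq_integrable_scale sq_integrable_id sq_integrable_const)
  have "first_moment u = d * v"
    using first_moment_eq[of u] L2
      ip_add_left[OF sq_integrable_const[of c] sq_integrable_scale[OF sq_integrable_id, of d] sq_integrable_id]
      ip_scale_left[of nu c "\<lambda>x. 1" "\<lambda>x. x"] ip_id_one
    by (simp add: u_def ip_scale_left v_def ip_commute)
  moreover have \<mu>u: "\<mu> i = u" for i by (simp add: \<mu>_def u_def[abs_def])
  ultimately have "(\<Sum>j\<in>UNIV. a j * al j * first_moment (\<mu> j)) = A * (d * v)"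
    using sum_distrib_right[of "\<lambda>j. a j * al j" UNIV "d * v"] A by (simp add: abar_def)
  \<comment> \<open>Criticality enters only here: the interaction feeds back exactly the slope
    \<open>d\<close>, so that the drift term becomes \<open>- (1 / beta) * u'\<close> and cancels
    the diffusion.\<close>
  then have m: "(\<Sum>j\<in>UNIV. a j * al j * first_moment (\<mu> j)) = d / beta"
    using crit beta_pos by (simp add: field_simps)
  have op: "lin_op a al s \<mu> i x = 0" for i x
  proof -
    have "(\<lambda>y. dU y * u y - d / beta * rho y) = (\<lambda>y. - (1 / beta) * u' y)"
      using beta_pos by (auto simp: u'_def field_simps)
    then have "deriv (\<lambda>y. dU y * \<mu> i y - d / beta * rho y) x = - (1 / beta) * deriv u' x"
      using deriv_cmult[OF d2, of "- (1 / beta)" x] by (simp add: \<mu>u)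
    then show ?thesis
      unfolding lin_op_eq[OF A] m by (simp add: \<mu>u du)
  qed
  have "in_L2 rho (\<lambda>x. \<mu> i x / rho x)" for i
    using L2 by (simp add: in_L2_iff \<mu>_def)
  moreover have "in_L2 rho (\<lambda>x. lin_op a al s \<mu> i x / rho x)" for i
    using sq_integrable_const[of 0] by (simp add: in_L2_iff op)
  moreover have "u field_differentiable at x" for x
    using d1 by (auto simp: field_differentiable_def)
  ultimately show "\<mu> \<in> lin_dom a al s"
    using d2 by (simp add: lin_dom_def Let_def A \<mu>u du)
  show "lin_op a al s \<mu> i x = 0" by (rule op)
qed

text \<open>On the kernel each \<open>f^i\<close> is a constant \<open>c i\<close>, so
  \<open>h^i = c i + beta m x\<close> with one slope shared by all species. The constant is the mass
  of the component, hence a common mass leaves two parameters.\<close>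

lemma null_space_common_mass:
  fixes a al :: "'m::finite \<Rightarrow> real"
  assumes A: "abar a al = A" and crit: "A * beta * v = 1"
  shows "lin_null_space a al s \<inter> common_mass = {\<mu>. \<exists>c d. \<mu> = (\<lambda>i x. (c + d * x) * rho x)}"
proof (intro equalityI subsetI)
  fix \<mu> :: "'m \<Rightarrow> real \<Rightarrow> real"
  assume \<mu>: "\<mu> \<in> lin_null_space a al s \<inter> common_mass"
  define m where "m = (\<Sum>j\<in>UNIV. a j * al j * first_moment (\<mu> j))"
  have dom: "\<mu> \<in> lin_dom a al s" and op: "\<And>i x. lin_op a al s \<mu> i x = 0"
    using \<mu> by (auto simp: lin_null_space_def)
  have "\<exists>c. \<forall>x. \<mu> i x / rho x - beta * m * x = c" for i
    using gen_zero_imp_const lin_dom_gen[OF A dom, of i] by (fastforce simp: op m_def)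
  then obtain c where c: "\<And>i x. \<mu> i x / rho x - beta * m * x = c i" by metis
  have \<mu>_eq: "\<mu> i = (\<lambda>x. (c i + beta * m * x) * rho x)" for i
    using c[of i] by (auto simp: field_simps)
  have "mass (\<mu> i) = c i" for i
  proof -
    have "mass (\<mu> i) = (\<integral>x. c i * rho x + beta * m * (x * rho x) \<partial>lborel)"
      by (simp add: \<mu>_eq mass_def distrib_right mult.assoc)
    also have "\<dots> = c i"
      using integrable_rho integrable_rho_moment[of 1] by (simp add: integral_rho integral_odd_rho)
    finally show ?thesis .
  qed
  \<comment> \<open>\<open>undefined\<close> serves as an arbitrary reference index; types are
    nonempty.\<close>
  then have "c i = c undefined" for i
    using \<mu> unfolding common_mass_def by (metis (mono_tags, lifting) IntD2 mem_Collect_eq)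
  then have "\<mu> = (\<lambda>i x. (c undefined + beta * m * x) * rho x)"
    using \<mu>_eq by metis
  then show "\<mu> \<in> {\<mu>. \<exists>c d. \<mu> = (\<lambda>i x. (c + d * x) * rho x)}" by blast
next
  fix \<mu> :: "'m \<Rightarrow> real \<Rightarrow> real"
  assume "\<mu> \<in> {\<mu>. \<exists>c d. \<mu> = (\<lambda>i x. (c + d * x) * rho x)}"
  then obtain c d where \<mu>: "\<mu> = (\<lambda>i x. (c + d * x) * rho x)" by blast
  have "integrable lborel (\<lambda>x. c * rho x + d * (x * rho x))"
    using integrable_rho integrable_rho_moment[of 1] by simp
  then have "\<mu> \<in> common_mass"
    by (simp add: common_mass_def \<mu> distrib_right mult.assoc)
  then show "\<mu> \<in> lin_null_space a al s \<inter> common_mass"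
    using affine_mult_rho_lin_op[OF A crit \<mu>] by (simp add: lin_null_space_def)
qed

lemma span_null_space:
  fixes rho_tuple xrho_tuple :: "'m::finite \<Rightarrow> real \<Rightarrow> real"
  assumes e1: "rho_tuple = (\<lambda>i. rho)" and e2: "xrho_tuple = (\<lambda>i x. x * rho x)"
  shows "tuple.span {rho_tuple, xrho_tuple} = {\<mu>. \<exists>c d. \<mu> = (\<lambda>i x. (c + d * x) * rho x)}"
    and "tuple.dim {\<mu> :: 'm \<Rightarrow> real \<Rightarrow> real. \<exists>c d. \<mu> = (\<lambda>i x. (c + d * x) * rho x)} = 2"
proof -
  have comb: "(\<lambda>i x. (c + d * x) * rho x) = tuple_scale c rho_tuple + tuple_scale d xrho_tuple" for c d
    by (auto simp: tuple_scale_def e1 e2 fun_eq_iff algebra_simps)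
  show span: "tuple.span {rho_tuple, xrho_tuple} = {\<mu>. \<exists>c d. \<mu> = (\<lambda>i x. (c + d * x) * rho x)}"
    unfolding comb
    by (auto simp: tuple.span_insert tuple.span_singleton algebra_simps)
  have indep: "c = 0 \<and> d = 0" if "tuple_scale c rho_tuple + tuple_scale d xrho_tuple = 0" for c d
  proof -
    have eq: "(c + d * x) * rho x = 0" for x
      using comb[of c d] that by (metis zero_fun_def)
    \<comment> \<open>Since \<open>rho\<close> never vanishes, evaluation at 0 gives
      \<open>c = 0\<close> and at 1 gives \<open>c + d = 0\<close>.\<close>
    show ?thesis using eq[of 0] eq[of 1] by simp
  qed
  have ne: "rho_tuple \<noteq> xrho_tuple"
    using indep[of 1 "-1"] by (auto simp: tuple_scale_def fun_eq_iff)
  have "tuple.independent {rho_tuple, xrho_tuple}"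
  proof -
    have "rho_tuple \<noteq> 0" using indep[of 1 0] by (auto simp: tuple_scale_def fun_eq_iff)
    moreover have "xrho_tuple \<notin> tuple.span {rho_tuple}"
    proof
      assume "xrho_tuple \<in> tuple.span {rho_tuple}"
      then obtain c where "xrho_tuple = tuple_scale c rho_tuple"
        by (auto simp: tuple.span_singleton)
      then show False using indep[of "- c" 1] by (auto simp: tuple_scale_def fun_eq_iff)
    qed
    ultimately show ?thesis
      unfolding insert_commute[of rho_tuple xrho_tuple "{}"]
      using ne by (simp add: tuple.independent_insert)
  qed
  from tuple.dim_span_eq_card_independent[OF this] ne
  show "tuple.dim {\<mu> :: 'm \<Rightarrow> real \<Rightarrow> real. \<exists>c d. \<mu> = (\<lambda>i x. (c + d * x) * rho x)} = 2"
    by (simp add: span)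
qed

end

theorem proposition4p1:
  fixes a al sg :: "'m::finite \<Rightarrow> real"
    and alij :: "'m \<Rightarrow> 'm \<Rightarrow> real"
    and V :: "'m \<Rightarrow> real \<Rightarrow> real"
    and F :: "'m \<Rightarrow> 'm \<Rightarrow> real \<Rightarrow> real"
    and s sc :: real
  assumes "\<And>i. 0 \<le> a i" and "\<And>i. a i \<le> 1" and "(\<Sum>i\<in>UNIV. a i) = 1"
    and "\<And>i. sg i > 0"
    and "\<And>i j x. F i j x = alij i j / 2 * x ^ 2"
    and "\<And>i j. alij i j \<ge> 0" and "\<And>i. alij i i > 0"
    and "s > 0"
    and "\<And>i j. alij i j / (sg i) ^ 2 = al j / s ^ 2"
    and "\<And>i x. V i x / (sg i) ^ 2 = Vbar x / s ^ 2"
    and "sc > 0" and "critical_equation (abar a al) sc"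
    and "\<And>r. r > 0 \<Longrightarrow> critical_equation (abar a al) r \<Longrightarrow> r = sc"
  shows
    "(s > sc \<longrightarrow>
        (\<exists>C>0. \<exists>r>0. \<forall>\<mu>. lin_solution a al s \<mu> \<and> (\<forall>i. mass (\<mu> 0 i) = 0) \<longrightarrow>
           (\<forall>t\<ge>0. perturbation_norm (gibbs (abar a al) s) (\<mu> t)
                    \<le> C * exp (- r * t) * perturbation_norm (gibbs (abar a al) s) (\<mu> 0))))
     \<and>
     (s = sc \<longrightarrow>
        lin_null_space a al s \<inter> common_mass =
          tuple.span {(\<lambda>i. gibbs (abar a al) s), (\<lambda>i x. x * gibbs (abar a al) s x)}
        \<and> tuple.dim (lin_null_space a al s \<inter> common_mass) = 2)"
proof -
  \<comment> \<open>The diagonal of the structural condition transfers the sign of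
    \<open>alij j j\<close> to \<open>al j\<close>. Since some weight is positive, the total weight
    \<open>abar a al\<close> is then positive as well.\<close>
  have al_pos: "0 < al j" for j
  proof -
    have "0 < alij j j / (sg j)\<^sup>2"
      using assms(4)[of j] assms(7)[of j] by (intro divide_pos_pos) simp_all
    then have "0 < al j / s\<^sup>2" using assms(9)[of j j] by simp
    then show ?thesis using \<open>s > 0\<close> by (simp add: zero_less_divide_iff)
  qed
  have w: "0 \<le> a i * al i" for i
    using assms(1)[of i] al_pos[of i] by simp
  have "0 < abar a al"
  proof -
    have "\<exists>i. a i \<noteq> 0"
    proof (rule ccontr)
      assume "\<not> ?thesis"
      then show False using assms(3) by simp
    qed
    then obtain i where "a i \<noteq> 0" by blast
    then have "0 < a i * al i" using assms(1)[of i] al_pos[of i] by simp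
    then show ?thesis
      unfolding abar_def using w by (intro sum_pos2[of UNIV i]) auto
  qed
  then interpret quartic_gibbs "abar a al" s
    using \<open>s > 0\<close> by unfold_locales
  show ?thesis
  proof (intro conjI impI)
    assume "s > sc"
    from lin_solution_decay[OF refl w subcritical[OF assms(11) assms(13) this]]
    show "\<exists>C>0. \<exists>r>0. \<forall>\<mu>. lin_solution a al s \<mu> \<and> (\<forall>i. mass (\<mu> 0 i) = 0) \<longrightarrow>
           (\<forall>t\<ge>0. perturbation_norm (gibbs (abar a al) s) (\<mu> t)
                    \<le> C * exp (- r * t) * perturbation_norm (gibbs (abar a al) s) (\<mu> 0))"
      by blast
  next
    assume "s = sc"
    then have "abar a al * beta * v = 1"
      using assms(12) critical_equation_iff by simp
    note null = null_space_common_mass[OF refl this]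
    show "lin_null_space a al s \<inter> common_mass =
          tuple.span {(\<lambda>i. gibbs (abar a al) s), (\<lambda>i x. x * gibbs (abar a al) s x)}"
      unfolding null span_null_space(1)[OF refl refl] ..
    show "tuple.dim (lin_null_space a al s \<inter> common_mass) = 2"
      unfolding null by (rule span_null_space(2)[OF refl refl])
  qed
qed

end
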